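(* Let $k\ge2$ be a constant, $f:(\{0,1\}^b)^k\to\{0,1\}$ and $\epsilon>0$. If a $\tilde{O}(|E||C|^{k-1-\epsilon})$ or $\tilde{O}(|E|^{1-\epsilon}|C|^{k-1})$ time algorithm exists for $k$-ELstC (respectively for counting $k$-ELstC mod $2^{2k\lg^2(n)}$), then a $\tilde{O}(n^{k-\epsilon})$ algorithm exists for F$k$-$f$ (respectively #F$k$-$f$).
   Context: $k$ Edge Labeled $st$ Connectivity ($k$-ELstC): input is a directed acyclic graph $G=(V,E)$, two vertices $s,t$, and an edge coloring $c:E\to C$; decide whether there exist $k$ colors such that some $s$–$t$ path uses only edges with those colors. The counting version asks for the number of $s$–$t$ paths using only $k$ colors, mod $R$. F$k$-$f$: with $g=o(\lg n/\lg\lg n)$, $b=o(\lg n)$, a $(g,b)$-factored vector is a $g$-tuple of sets $v[i]\subseteq\{0,1\}^b$; given $k$ sets $V_1,\dots,V_k$ of $n$ factored vectors each, #F$k$-$f$ outputs $\sum_{v_1\in V_1,\dots,v_k\in V_k}\prod_{i=1}^g\sum_{w_1\in v_1[i],\dots,w_k\in v_k[i]}f(w_1,\dots,w_k)$ and F$k$-$f$ asks whether it is positive. *)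

theory Defs
  imports Complex_Main "HOL-Library.Landau_Symbols"
begin

section \<open>Random access machines\<close>

text \<open>
  Structured programs for a RAM with unit cost operations. A state consists of the registers and
  of the addressable memory. Words are natural numbers below a bound \<open>B\<close>; a program
  that would compute a larger number has no execution. Taking \<open>B\<close> polynomial in the
  size of the instance gives the usual word RAM with words of logarithmically many bits.
\<close>

datatype alu = Add | Sub | Mul | Div | Mod | And | Or | Xor | Shl | Shr

context
  includes bit_operations_syntax
begin

fun alu_val :: "alu \<Rightarrow> nat \<Rightarrow> nat \<Rightarrow> nat" where
  "alu_val Add x y = x + y"
| "alu_val Sub x y = x - y"
| "alu_val Mul x y = x * y"
| "alu_val Div x y = x div y"
| "alu_val Mod x y = x mod y"
| "alu_val And x y = x AND y"
| "alu_val Or x y = x OR y"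
| "alu_val Xor x y = x XOR y"
| "alu_val Shl x y = push_bit y x"
| "alu_val Shr x y = drop_bit y x"

end

datatype prog =
    Skip
  | Const nat nat
  | Op alu nat nat nat
  | Load nat nat
  | Store nat nat
  | Seq prog prog
  | IfNZ nat prog prog
  | WhileNZ nat prog

type_synonym state = "(nat \<Rightarrow> nat) \<times> (nat \<Rightarrow> nat)"

text \<open>\<open>exec B p s \<tau> s'\<close>: with words below \<open>B\<close>, program \<open>p\<close> started in \<open>s\<close> halts in \<open>s'\<close>
  after \<open>\<tau>\<close> steps.\<close>

inductive exec :: "nat \<Rightarrow> prog \<Rightarrow> state \<Rightarrow> nat \<Rightarrow> state \<Rightarrow> bool" for B where
  "exec B Skip s 1 s"
| "x < B \<Longrightarrow> exec B (Const r x) (R, M) 1 (R(r := x), M)"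
| "alu_val a (R i) (R j) < B \<Longrightarrow>
     exec B (Op a r i j) (R, M) 1 (R(r := alu_val a (R i) (R j)), M)"
| "exec B (Load r i) (R, M) 1 (R(r := M (R i)), M)"
| "exec B (Store i r) (R, M) 1 (R, M(R i := R r))"
| "exec B p s \<tau> s' \<Longrightarrow> exec B q s' \<tau>' s'' \<Longrightarrow> exec B (Seq p q) s (\<tau> + \<tau>') s''"
| "R i \<noteq> 0 \<Longrightarrow> exec B p (R, M) \<tau> s' \<Longrightarrow> exec B (IfNZ i p q) (R, M) (Suc \<tau>) s'"
| "R i = 0 \<Longrightarrow> exec B q (R, M) \<tau> s' \<Longrightarrow> exec B (IfNZ i p q) (R, M) (Suc \<tau>) s'"
| "R i = 0 \<Longrightarrow> exec B (WhileNZ i p) (R, M) 1 (R, M)"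
| "R i \<noteq> 0 \<Longrightarrow> exec B p (R, M) \<tau> s' \<Longrightarrow> exec B (WhileNZ i p) s' \<tau>' s'' \<Longrightarrow>
     exec B (WhileNZ i p) (R, M) (Suc (\<tau> + \<tau>')) s''"

text \<open>Input and output occupy the memory cells from address 0 on; register 0 holds their length.\<close>

definition init_state :: "nat list \<Rightarrow> state" where
  "init_state xs =
     ((\<lambda>r. if r = 0 then length xs else 0), (\<lambda>a. if a < length xs then xs ! a else 0))"

fun out_words :: "state \<Rightarrow> nat list" where
  "out_words (R, M) = map M [0..<R 0]"

section \<open>Problems and running times\<close>

record 'i problem =
  instances :: "'i set"
  inst_size :: "'i \<Rightarrow> nat"
  encode :: "'i \<Rightarrow> nat list"
  correct :: "'i \<Rightarrow> nat list \<Rightarrow> bool"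

definition decides :: "bool \<Rightarrow> nat list \<Rightarrow> bool" where
  "decides P out \<longleftrightarrow> out = [of_bool P]"

text \<open>A number may exceed the word size, so it is output in binary, least significant bit first.\<close>

definition outputs_number :: "nat \<Rightarrow> nat list \<Rightarrow> bool" where
  "outputs_number N out \<longleftrightarrow> (\<exists>bs. out = map of_bool bs \<and> horner_sum of_bool 2 bs = N)"

definition subpolynomial :: "(nat \<Rightarrow> real) \<Rightarrow> bool" where
  "subpolynomial h \<longleftrightarrow> (\<forall>\<delta>>0. h \<in> O(\<lambda>n. real n powr \<delta>))"

text \<open>
  Here O-tilde hides factors \<open>N\<^bsup>o(1)\<^esup>\<close> in the size \<open>N\<close> of the instance. Polylogarithmic factors
  alone would be too few: \<open>n\<close> factored vectors already have up to \<open>n g 2\<^sup>b = n\<^bsup>1 + o(1)\<^esup>\<close> entries,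
  and this need not be \<open>n\<close> times a power of \<open>log n\<close>. All time bounds are understood to include
  the linear time for reading the instance: without it no algorithm at all would meet a bound
  such as \<open>|E|\<^bsup>1-\<epsilon>\<^esup> |C|\<^bsup>k-1\<^esup>\<close> on graphs with few colors.
\<close>

definition solvable_in_Otilde :: "'i problem \<Rightarrow> ('i \<Rightarrow> real) \<Rightarrow> bool" where
  "solvable_in_Otilde P T \<longleftrightarrow>
     (\<exists>p c h. subpolynomial h \<and>
       (\<forall>I\<in>instances P. \<exists>\<tau> s.
          exec ((inst_size P I + 2) ^ c) p (init_state (encode P I)) \<tau> s \<and>
          correct P I (out_words s) \<and>
          real \<tau> \<le> h (inst_size P I) * (1 + real (inst_size P I) + T I)))"

section \<open>Edge labeled \<open>st\<close> connectivity\<close>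

definition is_st_path :: "('v \<times> 'v) set \<Rightarrow> 'v \<Rightarrow> 'v \<Rightarrow> 'v list \<Rightarrow> bool" where
  "is_st_path E s t p \<longleftrightarrow>
     p \<noteq> [] \<and> hd p = s \<and> last p = t \<and> successively (\<lambda>u v. (u, v) \<in> E) p"

definition path_edges :: "'v list \<Rightarrow> ('v \<times> 'v) set" where
  "path_edges p = set (zip p (tl p))"

definition k_colored_st_paths ::
  "nat \<Rightarrow> ('v \<times> 'v) set \<Rightarrow> 'c set \<Rightarrow> ('v \<times> 'v \<Rightarrow> 'c) \<Rightarrow> 'v \<Rightarrow> 'v \<Rightarrow> 'v list set" where
  "k_colored_st_paths k E C c s t =
     {p. is_st_path E s t p \<and> (\<exists>K\<subseteq>C. card K = k \<and> c ` path_edges p \<subseteq> K)}"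

text \<open>The vertices are \<open>0, \<dots>, nverts - 1\<close> and the colors are \<open>0, \<dots>, ncolors - 1\<close>; the edges are
  listed without repetition in an arbitrary order.\<close>

record elst =
  nverts :: nat
  ncolors :: nat
  source :: nat
  target :: nat
  edge_list :: "(nat \<times> nat) list"
  color :: "nat \<times> nat \<Rightarrow> nat"

definition edges :: "elst \<Rightarrow> (nat \<times> nat) set" where
  "edges I = set (edge_list I)"

definition colors :: "elst \<Rightarrow> nat set" where
  "colors I = {..<ncolors I}"

definition elst_instances :: "elst set" where
  "elst_instances =
     {I. edges I \<subseteq> {..<nverts I} \<times> {..<nverts I} \<and> acyclic (edges I) \<and> distinct (edge_list I) \<and>
         source I < nverts I \<and> target I < nverts I \<and> color I ` edges I \<subseteq> colors I}"

definition elst_encode :: "elst \<Rightarrow> nat list" where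
  "elst_encode I =
     [nverts I, length (edge_list I), ncolors I, source I, target I] @
     concat (map (\<lambda>e. [fst e, snd e, color I e]) (edge_list I))"

definition elst_size :: "elst \<Rightarrow> nat" where
  "elst_size I = nverts I + card (edges I) + card (colors I)"

definition elst_paths :: "nat \<Rightarrow> elst \<Rightarrow> nat list set" where
  "elst_paths k I =
     k_colored_st_paths k (edges I) (colors I) (color I) (source I) (target I)"

definition ELstC :: "nat \<Rightarrow> elst problem" where
  "ELstC k = \<lparr>instances = elst_instances, inst_size = elst_size, encode = elst_encode,
     correct = (\<lambda>I. decides (elst_paths k I \<noteq> {}))\<rparr>"

definition count_ELstC_mod :: "nat \<Rightarrow> (nat \<Rightarrow> nat) \<Rightarrow> elst problem" where
  "count_ELstC_mod k R = \<lparr>instances = elst_instances, inst_size = elst_size, encode = elst_encode,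
     correct = (\<lambda>I. outputs_number (card (elst_paths k I) mod R (nverts I)))\<rparr>"

text \<open>\<open>2\<^bsup>2 k lg\<^sup>2 n\<^esup>\<close> with the exponent rounded up to an integer\<close>

definition ELstC_modulus :: "nat \<Rightarrow> nat \<Rightarrow> nat" where
  "ELstC_modulus k n = 2 ^ nat \<lceil>2 * real k * (log 2 (real n))\<^sup>2\<rceil>"

section \<open>Factored problems\<close>

type_synonym factored_vector = "bool list set list"

definition factored_vectors :: "nat \<Rightarrow> nat \<Rightarrow> factored_vector set" where
  "factored_vectors g b = {v. length v = g \<and> (\<forall>S\<in>set v. S \<subseteq> {w. length w = b})}"

definition factored_count :: "nat \<Rightarrow> (bool list list \<Rightarrow> bool) \<Rightarrow> factored_vector set list \<Rightarrow> nat" where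
  "factored_count g f Vs =
     (\<Sum>vs\<in>listset Vs. \<Prod>i<g. \<Sum>ws\<in>listset (map (\<lambda>v. v ! i) vs). of_bool (f ws))"

text \<open>
  An instance consists of \<open>n\<close> and of a listing of the sets \<open>V\<^sub>1, \<dots>, V\<^sub>k\<close>, of their elements, and
  of the elements of the components of these, each without repetition and in arbitrary order.
\<close>

type_synonym fk_instance = "nat \<times> bool list list list list list"

definition fk_sets :: "fk_instance \<Rightarrow> factored_vector set list" where
  "fk_sets I = map (\<lambda>V. set (map (map set) V)) (snd I)"

definition fk_instances :: "nat \<Rightarrow> (nat \<Rightarrow> nat) \<Rightarrow> (nat \<Rightarrow> nat) \<Rightarrow> fk_instance set" where
  "fk_instances k g b =
     {(n, X). length X = k \<and>
        (\<forall>V\<in>set X. length V = n \<and> distinct (map (map set) V) \<and>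
           (\<forall>v\<in>set V. map set v \<in> factored_vectors (g n) (b n) \<and> (\<forall>S\<in>set v. distinct S)))}"

text \<open>Since \<open>f\<close> is arbitrary, its \<open>2\<^bsup>k b\<^esup> = n\<^bsup>o(1)\<^esup>\<close> values (and those of \<open>g\<close> and \<open>b\<close>) have to be
  made available to the algorithm; \<open>f\<close> is given by its table, where the \<open>j\<close>-th argument is the
  \<open>j\<close>-th block of \<open>b\<close> bits of the index.\<close>

definition truth_table :: "nat \<Rightarrow> nat \<Rightarrow> (bool list list \<Rightarrow> bool) \<Rightarrow> nat list" where
  "truth_table k b f =
     map (\<lambda>x. of_bool (f (map (\<lambda>j. map (\<lambda>i. bit x (j * b + i)) [0..<b]) [0..<k]))) [0..<2 ^ (k * b)]"

definition set_encode :: "bool list list \<Rightarrow> nat list" where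
  "set_encode S = length S # map (horner_sum of_bool 2) S"

definition fk_encode ::
  "nat \<Rightarrow> (nat \<Rightarrow> nat) \<Rightarrow> (nat \<Rightarrow> nat) \<Rightarrow> (nat \<Rightarrow> bool list list \<Rightarrow> bool) \<Rightarrow> fk_instance \<Rightarrow> nat list" where
  "fk_encode k g b f = (\<lambda>(n, X).
     [n, g n, b n] @ truth_table k (b n) (f n) @ concat (map set_encode (concat (concat X))))"

definition F ::
  "nat \<Rightarrow> (nat \<Rightarrow> nat) \<Rightarrow> (nat \<Rightarrow> nat) \<Rightarrow> (nat \<Rightarrow> bool list list \<Rightarrow> bool) \<Rightarrow> fk_instance problem" where
  "F k g b f = \<lparr>instances = fk_instances k g b, inst_size = fst, encode = fk_encode k g b f,
     correct = (\<lambda>I. decides (factored_count (g (fst I)) (f (fst I)) (fk_sets I) > 0))\<rparr>"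

definition count_F ::
  "nat \<Rightarrow> (nat \<Rightarrow> nat) \<Rightarrow> (nat \<Rightarrow> nat) \<Rightarrow> (nat \<Rightarrow> bool list list \<Rightarrow> bool) \<Rightarrow> fk_instance problem" where
  "count_F k g b f = \<lparr>instances = fk_instances k g b, inst_size = fst, encode = fk_encode k g b f,
     correct = (\<lambda>I. outputs_number (factored_count (g (fst I)) (f (fst I)) (fk_sets I)))\<rparr>"

end

theory Submission
  imports Defs
begin

text \<open>
  Number the vectors of all \<open>V\<^sub>j\<close> by colors \<open>c < k n\<close>, so that \<open>c\<close> belongs to \<open>V\<^sub>j\<close> with
  \<open>j = c div n\<close>. The graph is a chain of sections \<open>i \<le> g\<close>. In a section a path first chooses an
  argument tuple \<open>x < 2\<^bsup>k b\<^esup>\<close> with \<open>f x = 1\<close> and then takes \<open>k\<close> double steps through a middle vertex;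
  step \<open>j\<close> can be made in color \<open>c\<close> of \<open>V\<^sub>j\<close> iff component \<open>j\<close> of \<open>x\<close> lies in component \<open>i\<close> of the
  vector \<open>c\<close>. A path meets every \<open>V\<^sub>j\<close>, so \<open>k\<close> colors are exactly a choice of one vector from each
  \<open>V\<^sub>j\<close>, and for a fixed choice the number of paths is the product over \<open>i\<close> of the numbers of
  suitable tuples. Hence the number of \<open>k\<close>-colored paths is the output of the factored problem, and it is
  below the modulus. The graph has \<open>k n\<close> colors and \<open>n\<^bsup>1 + o(1)\<^esup>\<close> vertices and edges, and a RAM program
  writes it in time \<open>n\<^bsup>1 + o(1)\<^esup>\<close>, after which the given algorithm takes over.
\<close>

section \<open>Reasoning about executions\<close>

text \<open>An edge is a pair of vertices with a single color, yet several vectors of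
  \<open>V\<^sub>j\<close> may contain the same word. Without middle vertices their edges would
  coincide; with one middle vertex per section, tuple and color they are distinct, and the color can
  be read off the edge. Since \<open>f\<close> looks at all \<open>k\<close> components at once, the
  tuple chosen at the start of a section must be carried along in the vertices until the section
  ends; forgetting it there makes the sections independent, whence the product of counts. The
  machine model shapes the rest. The given algorithm is only known to work from
  \<open>init_state\<close>, with words bounded by a power of its own instance size. So the
  reduction has to leave memory and registers exactly as in \<open>init_state\<close>, and all
  intermediate numbers must stay polynomial in \<open>n\<close>. The input lists the vectors in the
  order of the colors, so one pass over it suffices. All losses are collected in one factor
  \<open>overhead\<close>, which is \<open>n\<close> to the power o(1) and thus disappears in
  O-tilde.\<close>

lemma exec_mono_bound:
  assumes "exec B p s \<tau> s'" "B \<le> B'"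
  shows "exec B' p s \<tau> s'"
  using assms(1)
proof (induction rule: exec.induct)
  case (2 x r R M)
  with assms(2) show ?case by (intro exec.intros) simp
next
  case (3 a R i j r M)
  with assms(2) show ?case by (intro exec.intros) simp
qed (rule exec.intros; assumption)+

text \<open>A total-correctness triple for one start state. \<open>T\<close> is only an upper bound,
  so branches of different cost need no exact step count.\<close>

definition runs :: "nat \<Rightarrow> prog \<Rightarrow> state \<Rightarrow> nat \<Rightarrow> (state \<Rightarrow> bool) \<Rightarrow> bool" where
  "runs B p s T Q \<longleftrightarrow> (\<exists>\<tau> s'. \<tau> \<le> T \<and> exec B p s \<tau> s' \<and> Q s')"

lemma runs_mono:
  "runs B p s T Q \<Longrightarrow> T \<le> T' \<Longrightarrow> (\<And>s'. Q s' \<Longrightarrow> Q' s') \<Longrightarrow> runs B p s T' Q'"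
  unfolding runs_def by (meson le_trans)

lemma runs_step: "exec B p s (Suc 0) s' \<Longrightarrow> Q s' \<Longrightarrow> runs B p s (Suc 0) Q"
  unfolding runs_def by blast

lemma runs_Seq:
  assumes "runs B p s T P" "\<And>s'. P s' \<Longrightarrow> runs B q s' T' Q"
  shows "runs B (Seq p q) s (T + T') Q"
  using assms unfolding runs_def by (meson add_mono exec.intros(6))

text \<open>Weakest preconditions as a recursive function let the simplifier execute straight-line
  code symbolically; the word bound of \<open>exec\<close> becomes a conjunct. Loops get
  \<open>False\<close> and are left to \<open>runs_While\<close>.\<close>

fun loop_free_wp :: "nat \<Rightarrow> prog \<Rightarrow> (state \<Rightarrow> bool) \<Rightarrow> state \<Rightarrow> bool" where
  "loop_free_wp B Skip Q s = Q s"
| "loop_free_wp B (Const r x) Q (R, M) = (x < B \<and> Q (R(r := x), M))"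
| "loop_free_wp B (Op a r i j) Q (R, M) =
     (alu_val a (R i) (R j) < B \<and> Q (R(r := alu_val a (R i) (R j)), M))"
| "loop_free_wp B (Load r i) Q (R, M) = Q (R(r := M (R i)), M)"
| "loop_free_wp B (Store i r) Q (R, M) = Q (R, M(R i := R r))"
| "loop_free_wp B (Seq p q) Q s = loop_free_wp B p (loop_free_wp B q Q) s"
| "loop_free_wp B (IfNZ i p q) Q (R, M) =
     (if R i \<noteq> 0 then loop_free_wp B p Q (R, M) else loop_free_wp B q Q (R, M))"
| "loop_free_wp B (WhileNZ i p) Q s = False"

text \<open>Both branches of a conditional are charged, so the cost depends on the program
  alone.\<close>

fun loop_free_cost :: "prog \<Rightarrow> nat" where
  "loop_free_cost (Seq p q) = loop_free_cost p + loop_free_cost q"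
| "loop_free_cost (IfNZ i p q) = Suc (loop_free_cost p + loop_free_cost q)"
| "loop_free_cost _ = 1"

lemma runs_loop_free:
  "loop_free_wp B p Q s \<Longrightarrow> runs B p s (loop_free_cost p) Q"
proof (induction p arbitrary: Q s)
  case (Seq p q)
  from Seq.prems have "loop_free_wp B p (loop_free_wp B q Q) s" by simp
  from runs_Seq[OF Seq.IH(1)[OF this] Seq.IH(2)] show ?case by simp
next
  case (IfNZ i p q)
  obtain R M where s: "s = (R, M)" by force
  show ?case
  proof (cases "R i = 0")
    case True
    with IfNZ s have "runs B q (R, M) (loop_free_cost q) Q" by simp
    then obtain \<tau> s' where "\<tau> \<le> loop_free_cost q" "exec B q (R, M) \<tau> s'" "Q s'"
      unfolding runs_def by blast
    with True have "exec B (IfNZ i p q) (R, M) (Suc \<tau>) s'" by (intro exec.intros)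
    with \<open>Q s'\<close> \<open>\<tau> \<le> _\<close> show ?thesis
      unfolding runs_def s by (intro exI[of _ "Suc \<tau>"] exI[of _ s']) simp
  next
    case False
    with IfNZ s have "runs B p (R, M) (loop_free_cost p) Q" by simp
    then obtain \<tau> s' where "\<tau> \<le> loop_free_cost p" "exec B p (R, M) \<tau> s'" "Q s'"
      unfolding runs_def by blast
    with False have "exec B (IfNZ i p q) (R, M) (Suc \<tau>) s'" by (intro exec.intros)
    with \<open>Q s'\<close> \<open>\<tau> \<le> _\<close> show ?thesis
      unfolding runs_def s by (intro exI[of _ "Suc \<tau>"] exI[of _ s']) simp
  qed
next
  case (Const r x)
  thus ?case by (cases s) (auto intro: runs_step exec.intros(2)[unfolded One_nat_def])
next
  case (Op a r i j)
  thus ?case by (cases s) (auto intro: runs_step exec.intros(3)[unfolded One_nat_def])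
next
  case (Load r i)
  thus ?case by (cases s) (auto intro: runs_step exec.intros(4)[unfolded One_nat_def])
next
  case (Store i r)
  thus ?case by (cases s) (auto intro: runs_step exec.intros(5)[unfolded One_nat_def])
next
  case Skip
  thus ?case by (auto intro: runs_step exec.intros(1)[unfolded One_nat_def])
qed simp

lemma loop_free_wp_mono:
  "loop_free_wp B p Q s \<Longrightarrow> (\<And>s'. Q s' \<Longrightarrow> Q' s') \<Longrightarrow> loop_free_wp B p Q' s"
proof (induction p arbitrary: Q Q' s)
  case (Seq p q)
  show ?case using Seq.IH(1)[of "loop_free_wp B q Q" s "loop_free_wp B q Q'"] Seq.IH(2)[of Q _ Q'] Seq.prems
    by auto
next
  case (IfNZ i p q)
  obtain R M where "s = (R, M)" by force
  thus ?case using IfNZ.IH[of Q "(R, M)" Q'] IfNZ.prems by auto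
qed (case_tac s; simp)+

text \<open>Every loop of the reduction counts a register down, so the number \<open>N\<close> of
  rounds is known in advance and the invariant can be indexed by the round. Each round pays one more
  step for its test, and the failing test pays the last one.\<close>

lemma runs_While:
  assumes step: "\<And>m s. m < N \<Longrightarrow> I m s \<Longrightarrow> fst s r \<noteq> 0 \<and> runs B p s T (I (Suc m))"
    and stop: "\<And>s. I N s \<Longrightarrow> fst s r = 0"
    and init: "I 0 s"
  shows "runs B (WhileNZ r p) s (N * (T + 1) + 1) (I N)"
proof -
  \<comment> \<open>Going down from \<open>m = N\<close> matches the rule of \<open>exec\<close>
    that puts one round in front of the remaining loop.\<close>
  have "runs B (WhileNZ r p) s ((N - m) * (T + 1) + 1) (I N)" if "I m s" "m \<le> N" for m s
    using that(2,1)
  proof (induction m arbitrary: s rule: inc_induct)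
    case base
    obtain R M where s: "s = (R, M)" by force
    have "R r = 0" using stop[OF base] s by simp
    hence "exec B (WhileNZ r p) (R, M) 1 (R, M)" by (rule exec.intros)
    with base show ?case unfolding runs_def s by auto
  next
    case (step m)
    obtain R M where s: "s = (R, M)" by force
    from assms(1)[OF \<open>m < N\<close> step.prems] obtain \<tau> s'
      where 1: "R r \<noteq> 0" "\<tau> \<le> T" "exec B p (R, M) \<tau> s'" "I (Suc m) s'"
      unfolding runs_def s by auto
    from step.IH[OF 1(4)] obtain \<tau>' s''
      where 2: "\<tau>' \<le> (N - Suc m) * (T + 1) + 1" "exec B (WhileNZ r p) s' \<tau>' s''" "I N s''"
      unfolding runs_def by auto
    have "N - m = Suc (N - Suc m)" using \<open>m < N\<close> by simp
    hence "Suc (\<tau> + \<tau>') \<le> (N - m) * (T + 1) + 1" using 1 2 by simp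
    moreover have "exec B (WhileNZ r p) s (Suc (\<tau> + \<tau>')) s''"
      unfolding s using 1 2 by (intro exec.intros)
    ultimately show ?case using 2 unfolding runs_def by blast
  qed
  from this[of 0, OF init] show ?thesis by simp
qed

section \<open>Instruction sequences and memories that hold a list\<close>

fun seqs :: "prog list \<Rightarrow> prog" where
  "seqs [] = Skip"
| "seqs (p # ps) = Seq p (seqs ps)"

text \<open>The memory of \<open>init_state\<close>, with 0 beyond the list. Writing to the first
  free cell appends to the list, so the output is tracked as a growing list.\<close>

definition list_mem :: "nat list \<Rightarrow> nat \<Rightarrow> nat" where
  "list_mem xs a = (if a < length xs then xs ! a else 0)"

lemma list_mem_snoc: "(list_mem xs)(length xs := x) = list_mem (xs @ [x])"
  by (auto simp: list_mem_def fun_eq_iff nth_append)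

lemma list_mem_append_left: "a < length xs \<Longrightarrow> list_mem (xs @ ys) a = xs ! a"
  by (auto simp: list_mem_def nth_append)

lemma list_mem_append_drop:
  "drop p xs = y # ys \<Longrightarrow> list_mem (xs @ zs) p = y"
  by (cases "p < length xs") (auto simp: Cons_nth_drop_Suc[symmetric] list_mem_append_left)

lemma init_state_list_mem:
  "init_state xs = ((\<lambda>r. if r = 0 then length xs else 0), list_mem xs)"
  by (auto simp: init_state_def list_mem_def)

lemma length_concat_map_upt_prefix:
  "m < N \<Longrightarrow> length (concat (map f [0..<m])) + length (f m) \<le> length (concat (map f [0..<N]))"
proof (induction N)
  case (Suc N)
  thus ?case by (cases "m = N") auto
qed simp

lemma drop_Cons_imp:
  assumes "drop p xs = y # ys"
  shows "p < length xs" "drop (Suc p) xs = ys"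
  using assms by (cases "p < length xs", auto simp: Cons_nth_drop_Suc[symmetric])+

text \<open>The chain of updates is what symbolic execution of consecutive \<open>append_reg\<close>
  leaves. Five words make the header of a graph; the six of the next lemma are the two colored edges
  of an edge pair.\<close>

lemma list_mem_append5:
  assumes "p = length xs"
  shows "(list_mem xs)(p := a1, Suc p := a2, Suc (Suc p) := a3, Suc (Suc (Suc p)) := a4,
       Suc (Suc (Suc (Suc p))) := a5) = list_mem (xs @ [a1, a2, a3, a4, a5])"
  using list_mem_snoc[of xs a1] list_mem_snoc[of "xs @ [a1]" a2]
    list_mem_snoc[of "xs @ [a1, a2]" a3] list_mem_snoc[of "xs @ [a1, a2, a3]" a4]
    list_mem_snoc[of "xs @ [a1, a2, a3, a4]" a5] assms by simp

lemma list_mem_append6: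
  assumes "p = length xs"
  shows "(list_mem xs)(p := a1, Suc p := a2, Suc (Suc p) := a3, Suc (Suc (Suc p)) := a4,
       Suc (Suc (Suc (Suc p))) := a5, Suc (Suc (Suc (Suc (Suc p)))) := a6) =
     list_mem (xs @ [a1, a2, a3, a4, a5, a6])"
  using list_mem_snoc[of xs a1] list_mem_snoc[of "xs @ [a1]" a2]
    list_mem_snoc[of "xs @ [a1, a2]" a3] list_mem_snoc[of "xs @ [a1, a2, a3]" a4]
    list_mem_snoc[of "xs @ [a1, a2, a3, a4]" a5] list_mem_snoc[of "xs @ [a1, a2, a3, a4, a5]" a6]
    assms by simp

lemma loop_free_wp_clear:
  assumes "0 < B" "Q ((\<lambda>r. if r \<in> set rs then 0 else R r), M)"
  shows "loop_free_wp B (seqs (map (\<lambda>r. Const r 0) rs)) Q (R, M)"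
  using assms(2)
proof (induction rs arbitrary: R)
  case (Cons r rs)
  have "(\<lambda>r'. if r' \<in> set (r # rs) then 0 else R r') =
      (\<lambda>r'. if r' \<in> set rs then 0 else (R(r := 0)) r')" by auto
  with Cons show ?case using assms(1) by simp
qed simp

lemma loop_free_cost_clear: "loop_free_cost (seqs (map (\<lambda>r. Const r 0) rs)) = length rs + 1"
  by (induction rs) auto

lemma distinct_concat_map_upt:
  assumes "\<And>i. i < N \<Longrightarrow> distinct (f i)"
    "\<And>i j. i < N \<Longrightarrow> j < N \<Longrightarrow> i \<noteq> j \<Longrightarrow> set (f i) \<inter> set (f j) = {}"
  shows "distinct (concat (map f [0..<N]))"
  using assms
proof (induction N)
  case (Suc N)
  have "set (f i) \<inter> set (f N) = {}" if "i < N" for i using Suc.prems(2)[of i N] that by simp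
  moreover have "distinct (concat (map f [0..<N]))" using Suc by simp
  ultimately show ?case using Suc.prems(1)[of N] by (auto simp: disjoint_iff)
qed simp

lemma mult_add_div: "c < m \<Longrightarrow> (a * m + c) div m = (a :: nat)" by simp

lemma mult_add_mod: "c < m \<Longrightarrow> (a * m + c) mod m = (c :: nat)" by simp

lemma length_concat_map_le:
  "(\<And>x. x \<in> set xs \<Longrightarrow> length (f x) \<le> M) \<Longrightarrow> length (concat (map f xs)) \<le> length xs * M"
  by (induction xs) (auto intro: add_mono)

lemma length_concat_map_ge:
  "(\<And>x. x \<in> set xs \<Longrightarrow> M \<le> length (f x)) \<Longrightarrow> length xs * M \<le> length (concat (map f xs))"
  by (induction xs) (auto intro: add_mono)

section \<open>The reduction program\<close>

definition append_reg :: "nat \<Rightarrow> prog" where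
  "append_reg r = seqs [Store 0 r, Op Add 0 0 8]"

text \<open>
  Registers: 0 holds the end of the used memory, 1 the length of the input, 2 \<open>n\<close>, 3 \<open>b\<close>,
  4 \<open>2\<^bsup>k b\<^esup>\<close>, 5 \<open>k n\<close>, 6 the number of the first middle vertex, 7 \<open>2\<^sup>b\<close>, 8 the constant 1,
  9 \<open>k\<close>, 17 \<open>g\<close>. The loops use 10 as pointer into the input, 11 for the color \<open>c\<close>,
  12 for the section \<open>i\<close>, 14 for the current word, 15 for the argument tuple \<open>x\<close>, 16 for
  \<open>c div n\<close>, and 18, 19, 13, 20 for the numbers of remaining iterations.
\<close>

definition emit_prog :: prog where
  "emit_prog = seqs [
     Op Mul 21 12 9, Op Add 21 21 16,
     Op Mul 22 21 4, Op Sub 23 8 16, Op Sub 23 8 23, Op Mul 23 15 23, Op Add 22 22 23,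
     Op Add 21 21 8, Op Mul 24 21 4, Op Sub 23 9 8, Op Sub 23 23 16, Op Sub 23 8 23,
     Op Sub 23 8 23, Op Mul 23 15 23, Op Add 24 24 23,
     Op Mul 25 12 4, Op Add 25 25 15, Op Mul 25 25 5, Op Add 25 25 11, Op Add 25 6 25,
     append_reg 22, append_reg 25, append_reg 11, append_reg 25, append_reg 24, append_reg 11]"

text \<open>The truth table starts at address 3, behind \<open>n\<close>, \<open>g\<close> and
  \<open>b\<close>. Two numbers are compared through the sum of both truncated differences, which is
  0 only if they are equal.\<close>

definition tuple_body :: prog where
  "tuple_body = seqs [
     Const 21 3, Op Add 21 15 21, Load 21 21,
     IfNZ 21 (seqs [
       Op Mul 21 16 3, Op Shr 21 15 21, Op Mod 21 21 7,
       Op Sub 22 21 14, Op Sub 23 14 21, Op Add 22 22 23,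
       IfNZ 22 Skip emit_prog]) Skip,
     Op Add 15 15 8, Op Sub 20 20 8]"

text \<open>Adding a register that has just been set to 0 serves as a register copy, here of
  register 4 to 20.\<close>

definition word_body :: prog where
  "word_body =
     Seq (seqs [Load 14 10, Op Add 10 10 8, Const 15 0, Op Add 20 4 15])
       (Seq (WhileNZ 20 tuple_body) (Op Sub 13 13 8))"

definition section_body :: prog where
  "section_body =
     Seq (seqs [Load 13 10, Op Add 10 10 8])
       (Seq (WhileNZ 13 word_body) (seqs [Op Add 12 12 8, Op Sub 19 19 8]))"

definition color_body :: prog where
  "color_body =
     Seq (seqs [Op Div 16 11 2, Const 12 0, Op Add 19 17 12])
       (Seq (WhileNZ 19 section_body)
         (seqs [Const 15 0, emit_prog, Op Add 11 11 8, Op Sub 18 18 8]))"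

text \<open>The program may contain \<open>k\<close>, a constant, while \<open>g\<close> and
  \<open>b\<close> are read from the input. Register 27 is still 0 and supplies the placeholder for
  the edge count, the source, and the zero summand of a copy.\<close>

definition header_prog :: "nat \<Rightarrow> prog" where
  "header_prog k = seqs [
     Const 8 1, Const 9 k, Op Add 1 0 21, Load 2 21, Load 17 8, Const 21 2, Load 3 21,
     Op Shl 7 8 3, Op Mul 21 9 3, Op Shl 4 8 21, Op Mul 5 9 2,
     Op Mul 22 17 9, Op Add 22 22 9, Op Add 23 22 8, Op Mul 6 23 4, Op Mul 24 22 4,
     Op Add 25 17 8, Op Mul 25 25 4, Op Mul 25 25 5, Op Add 25 6 25, Op Shl 26 8 17,
     Op Add 25 25 26,
     append_reg 25, append_reg 27, append_reg 5, append_reg 27, append_reg 24,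
     Const 21 3, Op Add 10 21 4, Op Add 18 5 27]"

text \<open>The number of edges is only known at the end and is then written into the header. Moving
  all used cells down by the length of the input also clears what the result does not cover.\<close>

definition move_body :: prog where
  "move_body = seqs [Op Add 24 22 1, Load 24 24, Store 22 24, Op Add 22 22 8, Op Sub 23 23 8]"

definition finish_prog :: prog where
  "finish_prog =
     Seq (seqs [Op Sub 21 0 1, Const 22 5, Op Sub 22 21 22, Const 23 3, Op Div 22 22 23,
       Op Add 24 1 8, Store 24 22, Const 22 0, Op Add 23 0 22])
       (Seq (WhileNZ 23 move_body)
         (seqs (Const 22 0 # Op Add 0 21 22 # map (\<lambda>r. Const r 0) [1..<30])))"

definition reduction_prog :: "nat \<Rightarrow> prog" where
  "reduction_prog k = Seq (header_prog k) (Seq (WhileNZ 18 color_body) finish_prog)"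

text \<open>The instance in machine form: words are numbers below \<open>2 ^ b\<close>,
  \<open>f\<close> is the table \<open>tt\<close>, and the vectors of all sets form one list
  \<open>W\<close> indexed by color.\<close>

locale reduction =
  fixes k n g b :: nat and tt :: "nat list" and W :: "nat list list list"
  assumes k_ge_2: "k \<ge> 2"
    and length_tt: "length tt = 2 ^ (k * b)"
    and length_W: "length W = k * n"
    and length_vec: "v \<in> set W \<Longrightarrow> length v = g"
    and words: "v \<in> set W \<Longrightarrow> S \<in> set v \<Longrightarrow> distinct S \<and> set S \<subseteq> {..<2 ^ b}"
begin

definition X :: nat where "X = 2 ^ (k * b)"
definition mid_base :: nat where "mid_base = (g * k + k + 1) * X"
definition dest :: nat where "dest = (g * k + k) * X"
text \<open>The \<open>2\<^sup>g\<close> isolated vertices make \<open>lg\<close> of the number of vertices at least \<open>g\<close>, which keeps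
  the number of paths below the modulus for every \<open>n\<close>.\<close>

definition vertex_number :: nat where "vertex_number = mid_base + (g + 1) * X * (k * n) + 2 ^ g"

text \<open>Vertex number \<open>q\<close> of the chain remembers the tuple \<open>x\<close>, except
  at section boundaries, where all tuples share one vertex.\<close>

definition node :: "nat \<Rightarrow> nat \<Rightarrow> nat" where
  "node q x = q * X + (if k dvd q then 0 else x)"

definition mid :: "nat \<Rightarrow> nat \<Rightarrow> nat \<Rightarrow> nat" where
  "mid i x c = mid_base + ((i * X + x) * (k * n) + c)"

definition edge_pair :: "nat \<Rightarrow> nat \<Rightarrow> nat \<Rightarrow> (nat \<times> nat) list" where
  "edge_pair i x c =
     [(node (i * k + c div n) x, mid i x c), (mid i x c, node (i * k + c div n + 1) x)]"

definition tuple_edges :: "nat \<Rightarrow> nat \<Rightarrow> nat \<Rightarrow> nat \<Rightarrow> (nat \<times> nat) list" where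
  "tuple_edges c i w x =
     (if tt ! x \<noteq> 0 \<and> x div 2 ^ (c div n * b) mod 2 ^ b = w then edge_pair i x c else [])"

definition word_edges :: "nat \<Rightarrow> nat \<Rightarrow> nat \<Rightarrow> (nat \<times> nat) list" where
  "word_edges c i w = concat (map (tuple_edges c i w) [0..<X])"

definition section_edges :: "nat \<Rightarrow> nat list list \<Rightarrow> nat \<Rightarrow> (nat \<times> nat) list" where
  "section_edges c v i = concat (map (\<lambda>l. word_edges c i (v ! i ! l)) [0..<length (v ! i)])"

text \<open>The extra section \<open>g\<close>, with the dummy tuple 0 only, forces a path to use a color of every
  block \<open>{j n..<(j + 1) n}\<close>, even if \<open>g = 0\<close>.\<close>

definition color_edges :: "nat \<Rightarrow> (nat \<times> nat) list" where
  "color_edges c = concat (map (section_edges c (W ! c)) [0..<g]) @ edge_pair g 0 c"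

definition all_edges :: "(nat \<times> nat) list" where
  "all_edges = concat (map color_edges [0..<k * n])"

text \<open>All nodes lie below \<open>mid_base\<close>, so the larger end of an edge is its middle
  vertex, and the last mixed-radix digit of that is the color.\<close>

definition edge_color :: "nat \<times> nat \<Rightarrow> nat" where
  "edge_color e = (max (fst e) (snd e) - mid_base) mod (k * n)"

definition graph :: elst where
  "graph = \<lparr>nverts = vertex_number, ncolors = k * n, source = 0, target = dest,
     edge_list = all_edges, color = edge_color\<rparr>"

definition stream :: "nat list" where
  "stream = concat (map (\<lambda>S. length S # S) (concat W))"

definition inp :: "nat list" where
  "inp = [n, g, b] @ tt @ stream"

definition colored_words :: "nat \<Rightarrow> (nat \<times> nat) list \<Rightarrow> nat list" where
  "colored_words c es = concat (map (\<lambda>e. [fst e, snd e, c]) es)"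

lemma X_pos: "X > 0" by (simp add: X_def)

lemma dest_le: "dest + X = mid_base" by (simp add: dest_def mid_base_def algebra_simps)

lemma mid_base_le: "mid_base < vertex_number" by (simp add: vertex_number_def)

lemma color_div_less: "c < k * n \<Longrightarrow> c div n < k"
  by (metis less_mult_imp_div_less mult.commute)

lemma mid_less: 
  assumes "i \<le> g" "x < X" "c < k * n"
  shows "mid i x c < vertex_number"
proof -
  have "(i * X + x) * (k * n) + c < (i * X + x + 1) * (k * n)" using assms by simp
  also have "i * X + x + 1 \<le> (i + 1) * X" using assms by simp
  hence "(i * X + x + 1) * (k * n) \<le> (i + 1) * X * (k * n)" by (rule mult_le_mono1)
  also have "\<dots> \<le> (g + 1) * X * (k * n)" using assms by (intro mult_le_mono1) simp
  finally show ?thesis unfolding mid_def vertex_number_def by simp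
qed

lemma node_less:
  assumes "i \<le> g" "x < X" "j < k"
  shows "node (i * k + j) x < mid_base" "node (i * k + j + 1) x < mid_base"
proof -
  have "i * k \<le> g * k" using assms by simp
  hence 1: "i * k + j + 1 \<le> g * k + k" using assms(3) by linarith
  have "(i * k + j + 1) * X \<le> dest" unfolding dest_def by (rule mult_le_mono1[OF 1])
  thus "node (i * k + j) x < mid_base" "node (i * k + j + 1) x < mid_base"
    using assms dest_le unfolding node_def by (auto simp: algebra_simps)
qed

text \<open>The left sides are what \<open>emit_prog\<close> computes. With truncated subtraction
  \<open>1 - (1 - j)\<close> is 0 for \<open>j = 0\<close> and 1 otherwise, so the tuple is dropped
  at a boundary without a branch; \<open>k - 1 - j\<close> does the same at the far end.\<close>

lemma node_conv:
  assumes "j < k"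
  shows "(i * k + j) * X + x * (1 - (1 - j)) = node (i * k + j) x"
    "(i * k + j + 1) * X + x * (1 - (1 - (k - 1 - j))) = node (i * k + j + 1) x"
proof -
  have "k dvd i * k + j \<longleftrightarrow> j = 0" using assms
    by (metis dvd_add_right_iff dvd_triv_right gcd_nat.extremum nat_dvd_not_less neq0_conv)
  thus "(i * k + j) * X + x * (1 - (1 - j)) = node (i * k + j) x"
    unfolding node_def by (cases j) auto
  have "k dvd i * k + (j + 1) \<longleftrightarrow> j + 1 = k" using assms
    by (metis One_nat_def Suc_leI add.right_neutral add_Suc_right dvd_add_right_iff dvd_refl dvd_triv_right linorder_not_le nat_dvd_not_less order_le_less zero_less_Suc)
  hence "k dvd i * k + j + 1 \<longleftrightarrow> j + 1 = k" by (simp add: add.assoc)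
  thus "(i * k + j + 1) * X + x * (1 - (1 - (k - 1 - j))) = node (i * k + j + 1) x"
    unfolding node_def using assms by (cases "k - 1 - j") auto
qed

end

section \<open>Correctness of the program\<close>

text \<open>\<open>vertex_number\<close> dominates the computed values, the second bound the
  addresses. The input counts twice because the final move runs over input and output and reads each
  cell at a distance of \<open>length inp\<close>.\<close>

locale bounded_reduction = reduction +
  fixes B :: nat
  assumes vertex_number_less_B: "vertex_number < B"
    and length_less_B: "2 * length inp + 5 + 3 * length all_edges < B"
begin

lemma small_less_B: "n < B" "g < B" "k < B" "k * b < B" "X < B" "2 ^ b < B" "k * n < B" "11 < B"
  "mid_base < B" "b < B"
proof -
  show mb: "mid_base < B" using mid_base_le vertex_number_less_B by simp
  have "1 * (k * n) \<le> (g + 1) * X * (k * n)" using X_pos by (intro mult_le_mono1) simp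
  thus kn: "k * n < B" using vertex_number_less_B unfolding vertex_number_def by linarith
  have "1 * n \<le> k * n" using k_ge_2 by (intro mult_le_mono1) auto
  thus "n < B" using kn by linarith
  have "g < 2 ^ g" by simp
  thus "g < B" using vertex_number_less_B unfolding vertex_number_def by linarith
  have "k * 1 \<le> (g * k + k + 1) * X" using X_pos by (intro mult_mono) auto
  thus "k < B" using mb unfolding mid_base_def by simp
  have "1 * X \<le> (g * k + k + 1) * X" by (intro mult_mono) auto
  thus X: "X < B" using mb unfolding mid_base_def by simp
  have "k * b < X" unfolding X_def by simp
  thus kb: "k * b < B" using X by simp
  have "1 * b \<le> k * b" using k_ge_2 by (intro mult_le_mono1) auto
  thus "b < B" using kb by linarith
  have "(2::nat) ^ b \<le> X" using \<open>1 * b \<le> k * b\<close> unfolding X_def by (intro power_increasing) auto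
  thus "2 ^ b < B" using X by simp
  \<comment> \<open>The three leading words of \<open>inp\<close> already give
    \<open>2 * 3 + 5\<close>; this covers the literal constants of the programs.\<close>
  show "11 < B" using length_less_B by (simp add: inp_def)
qed

lemma emit_prog_runs:
  assumes "i \<le> g" "x < X" "c < k * n"
    and regs: "R 0 = length inp + length out" "R 4 = X" "R 5 = k * n" "R 6 = mid_base" "R 8 = 1"
      "R 9 = k" "R 11 = c" "R 12 = i" "R 15 = x" "R 16 = c div n"
    and space: "length inp + length out + 6 < B"
  shows "loop_free_wp B emit_prog
    (\<lambda>(R', M'). M' = list_mem (inp @ out @ colored_words c (edge_pair i x c)) \<and> R' 0 = R 0 + 6 \<and>
       (\<forall>r. r \<noteq> 0 \<longrightarrow> r \<notin> {21..25} \<longrightarrow> R' r = R r)) (R, list_mem (inp @ out))"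
proof -
  define j where "j = c div n"
  have j: "j < k" unfolding j_def using assms color_div_less by simp
  have nc: "(i * k + j) * X + x * (Suc 0 - (Suc 0 - j)) = node (i * k + j) x"
    "X + (i * k + j) * X + x * (Suc 0 - (Suc 0 - (k - Suc j))) = node (Suc (i * k + j)) x"
    using node_conv[OF j, of i x] by simp_all
  note nl = node_less[OF assms(1,2) j]
  \<comment> \<open>Register 21 holds the node index before the multiplication by \<open>X\<close>,
    so the index itself must fit into a word.\<close>
  have le: "i * k + j < (i * k + j + 1) * X"
    using mult_le_mono2[of 1 X "i * k + j + 1"] X_pos by simp
  have b1: "Suc (i * k + j) < B" "(i * k + j) * X < B" "X + (i * k + j) * X < B"
     "x * (Suc 0 - (Suc 0 - j)) < B" "x * (Suc 0 - (Suc 0 - (k - Suc j))) < B"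
     "node (i * k + j) x < B" "node (Suc (i * k + j)) x < B"
    using nl nc le small_less_B(9) by simp_all
  have "i * X + x < (i + 1) * X" using assms by simp
  also have "\<dots> \<le> (g + 1) * X" using assms by (intro mult_le_mono1) simp
  also have "\<dots> \<le> (g * k + k + 1) * X" using k_ge_2 by (intro mult_le_mono1) (simp add: trans_le_add1)
  finally have b2: "i * X + x < B" using small_less_B(9) unfolding mid_base_def by simp
  have b3: "mid_base + ((i * X + x) * (k * n) + c) < B"
    using mid_less[OF assms(1-3)] vertex_number_less_B unfolding mid_def by simp
  have ws: "colored_words c (edge_pair i x c) =
      [node (i * k + j) x, mid i x c, c, mid i x c, node (Suc (i * k + j)) x, c]"
    unfolding colored_words_def edge_pair_def j_def by simp
  show ?thesis
    unfolding emit_prog_def append_reg_def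
    using b1 b2 b3 space small_less_B
    by (simp add: regs j_def[symmetric] nc ws list_mem_append6 mid_def) (intro conjI; linarith)
qed

text \<open>The invariants are nested, one layer per loop: \<open>out\<close> is the output so far,
  \<open>rest\<close> the unread part of the input at register 10. Registers from 30 on are recorded
  as 0 because the final cleanup resets only those below.\<close>

definition glob :: "nat list \<Rightarrow> state \<Rightarrow> bool" where
  "glob out s \<longleftrightarrow> snd s = list_mem (inp @ out) \<and> fst s 0 = length inp + length out \<and>
     fst s 1 = length inp \<and> fst s 2 = n \<and> fst s 3 = b \<and> fst s 4 = X \<and> fst s 5 = k * n \<and>
     fst s 6 = mid_base \<and> fst s 7 = 2 ^ b \<and> fst s 8 = 1 \<and> fst s 9 = k \<and> fst s 17 = g \<and>
     (\<forall>r\<ge>30. fst s r = 0)"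

definition at_color :: "nat list \<Rightarrow> nat list \<Rightarrow> nat \<Rightarrow> state \<Rightarrow> bool" where
  "at_color out rest c s \<longleftrightarrow> glob out s \<and> drop (fst s 10) inp = rest \<and> fst s 11 = c \<and>
     fst s 18 = k * n - c"

definition at_section :: "nat list \<Rightarrow> nat list \<Rightarrow> nat \<Rightarrow> nat \<Rightarrow> state \<Rightarrow> bool" where
  "at_section out rest c i s \<longleftrightarrow> at_color out rest c s \<and> fst s 16 = c div n \<and> fst s 12 = i \<and>
     fst s 19 = g - i"

definition at_word :: "nat list \<Rightarrow> nat list \<Rightarrow> nat \<Rightarrow> nat \<Rightarrow> nat \<Rightarrow> state \<Rightarrow> bool" where
  "at_word out rest c i e s \<longleftrightarrow> at_section out rest c i s \<and> fst s 13 = e"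

definition at_tuple ::
  "nat list \<Rightarrow> nat list \<Rightarrow> nat \<Rightarrow> nat \<Rightarrow> nat \<Rightarrow> nat \<Rightarrow> nat \<Rightarrow> state \<Rightarrow> bool" where
  "at_tuple out rest c i e w x s \<longleftrightarrow> at_word out rest c i e s \<and> fst s 14 = w \<and> fst s 15 = x \<and>
     fst s 20 = X - x"

lemmas at_defs = glob_def at_color_def at_section_def at_word_def at_tuple_def

lemma tuple_body_runs:
  assumes "i \<le> g" "x < X" "c < k * n" "w < 2 ^ b"
    and space: "length inp + length out + length (colored_words c (tuple_edges c i w x)) < B"
    and s: "at_tuple out rest c i e w x s"
  shows "runs B tuple_body s 80
    (at_tuple (out @ colored_words c (tuple_edges c i w x)) rest c i e w (Suc x))"
proof -
  obtain R where s_eq: "s = (R, list_mem (inp @ out))"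
    using s unfolding at_defs by (metis prod.collapse)
  have regs: "R 0 = length inp + length out" "R 4 = X" "R 5 = k * n" "R 6 = mid_base" "R 8 = 1"
      "R 9 = k" "R 11 = c" "R 12 = i" "R 15 = x" "R 16 = c div n" "R 3 = b" "R 7 = 2 ^ b" "R 14 = w"
      "R 20 = X - x" "R (Suc 0) = length inp" "R 2 = n" "R 17 = g" "drop (R 10) inp = rest" "R 18 = k * n - c"
      "R 19 = g - i" "R 13 = e" "\<And>r. r \<ge> 30 \<Longrightarrow> R r = 0"
    using s unfolding s_eq at_defs by simp_all
  have tt: "list_mem (inp @ out) (x + 3) = tt ! x"
    using assms(2) length_tt unfolding inp_def X_def by (simp add: list_mem_def nth_append)
  have "c div n * b \<le> k * b" using color_div_less[OF assms(3)] by simp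
  hence jb: "c div n * b < B" using small_less_B(4) by linarith
  have xB: "x < B" using assms small_less_B by simp
  have "x + 3 < length inp" using assms(2) length_tt unfolding inp_def X_def by simp
  hence x3: "x + 3 < B" using length_less_B by simp
  have xs: "X - Suc x < B" using small_less_B(5) by linarith
  define u where "u = x div 2 ^ (c div n * b) mod 2 ^ b"
  have u: "u < 2 ^ b" unfolding u_def by simp
  have uw: "w - u < B" "u - w + (w - u) < B" using u assms(4) small_less_B(6) by linarith+
  have u1: "x div 2 ^ (c div n * b) < B" using xB div_le_dividend le_less_trans by blast
  have "loop_free_wp B tuple_body
    (at_tuple (out @ colored_words c (tuple_edges c i w x)) rest c i e w (Suc x)) s"
  proof (cases "tt ! x \<noteq> 0 \<and> u = w")
    case True
    hence te: "tuple_edges c i w x = edge_pair i x c" unfolding tuple_edges_def u_def by simp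
    have "length inp + length out + 6 < B"
      using space unfolding te colored_words_def edge_pair_def by simp
    \<comment> \<open>The registers on entry to \<open>emit_prog\<close>: 21 holds the extracted
      component, equal to \<open>w\<close>, and both differences are 0.\<close>
    define R' where "R' = R(21 := w, 23 := 0, 22 := 0)"
    have e: "loop_free_wp B emit_prog
    (\<lambda>(R'', M'). M' = list_mem (inp @ out @ colored_words c (edge_pair i x c)) \<and> R'' 0 = R' 0 + 6 \<and>
       (\<forall>r. r \<noteq> 0 \<longrightarrow> r \<notin> {21..25} \<longrightarrow> R'' r = R' r)) (R', list_mem (inp @ out))"
      by (rule emit_prog_runs[OF assms(1-3)]) (use regs \<open>_ + 6 < B\<close> in \<open>auto simp: R'_def\<close>)
    show ?thesis
      unfolding s_eq tuple_body_def using jb xB x3 u1 u small_less_B True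
      apply (simp add: regs tt drop_bit_eq_div u_def[symmetric] del: One_nat_def)
      apply (rule loop_free_wp_mono[OF e[unfolded R'_def]])
      subgoal for s' using x3 xs
        by (cases s') (simp add: at_defs te regs colored_words_def edge_pair_def)
      done
  next
    case False
    hence te: "tuple_edges c i w x = []" unfolding tuple_edges_def u_def by auto
    show ?thesis 
      unfolding s_eq tuple_body_def using jb xB x3 u1 u small_less_B False
      apply (simp add: regs tt drop_bit_eq_div u_def[symmetric] te)
      using x3 xs uw by (auto simp add: at_defs te regs colored_words_def)
  qed
  from runs_loop_free[OF this] show ?thesis
    by (rule runs_mono) (simp_all add: tuple_body_def emit_prog_def append_reg_def)
qed

lemma colored_words_append: "colored_words c (es @ es') = colored_words c es @ colored_words c es'"
  unfolding colored_words_def by simp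

lemma colored_words_Nil: "colored_words c [] = []"
  unfolding colored_words_def by simp

lemma length_colored_words: "length (colored_words c es) = 3 * length es"
  unfolding colored_words_def by (induction es) auto

lemma tuple_loop_runs:
  assumes "i \<le> g" "c < k * n" "w < 2 ^ b"
    and space: "length inp + length out + 3 * length (word_edges c i w) < B"
    and s: "at_tuple out rest c i e w 0 s"
  shows "runs B (WhileNZ 20 tuple_body) s (X * 81 + 1)
    (at_tuple (out @ colored_words c (word_edges c i w)) rest c i e w X)"
proof -
  let ?I = "\<lambda>m. at_tuple (out @ colored_words c (concat (map (tuple_edges c i w) [0..<m]))) rest c i e w m"
  have "runs B (WhileNZ 20 tuple_body) s (X * (80 + 1) + 1) (?I X)"
  proof (rule runs_While[where I = ?I])
    fix m s assume m: "m < X" and s: "?I m s"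
    have "runs B tuple_body s 80 (at_tuple ((out @ colored_words c (concat (map (tuple_edges c i w) [0..<m])))
       @ colored_words c (tuple_edges c i w m)) rest c i e w (Suc m))"
      by (rule tuple_body_runs[OF assms(1) m assms(2,3) _ s])
        (use space length_concat_map_upt_prefix[OF m, of "tuple_edges c i w"]
          in \<open>simp add: length_colored_words word_edges_def\<close>)
    thus "fst s 20 \<noteq> 0 \<and> runs B tuple_body s 80 (?I (Suc m))"
      using s m by (simp add: colored_words_append at_tuple_def)
  next
    show "?I 0 s" using s by (simp add: colored_words_Nil)
  qed (simp add: at_tuple_def)
  thus ?thesis by (simp add: word_edges_def)
qed

lemma word_body_runs:
  assumes "i \<le> g" "c < k * n" "w < 2 ^ b" and e: "e < B"
    and space: "length inp + length out + 3 * length (word_edges c i w) < B"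
    and s: "at_word out (w # rest) c i (Suc e) s"
  shows "runs B word_body s (X * 81 + 10)
    (at_word (out @ colored_words c (word_edges c i w)) rest c i e)"
proof -
  obtain R where s_eq: "s = (R, list_mem (inp @ out))"
    using s unfolding at_defs by (metis prod.collapse)
  have regs: "R 0 = length inp + length out" "R 4 = X" "R 5 = k * n" "R 6 = mid_base" "R 8 = 1"
      "R 9 = k" "R 11 = c" "R 12 = i" "R 16 = c div n" "R 3 = b" "R 7 = 2 ^ b"
      "R (Suc 0) = length inp" "R 2 = n" "R 17 = g" "R 18 = k * n - c"
      "R 19 = g - i" "R 13 = Suc e" "\<And>r. r \<ge> 30 \<Longrightarrow> R r = 0"
    using s unfolding s_eq at_defs by simp_all
  have d: "drop (R 10) inp = w # rest" using s unfolding s_eq at_defs by simp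
  note d' = drop_Cons_imp[OF d] list_mem_append_drop[OF d]
  have p: "Suc (R 10) < B" using d'(1) length_less_B by linarith
  have "loop_free_wp B (seqs [Load 14 10, Op Add 10 10 8, Const 15 0, Op Add 20 4 15])
     (at_tuple out rest c i (Suc e) w 0) s"
    unfolding s_eq using p small_less_B by (simp add: regs d' at_defs)
  note 1 = runs_loop_free[OF this]
  have 3: "runs B (Op Sub 13 13 8) s' 1 (at_word (out @ colored_words c (word_edges c i w)) rest c i e)"
    if s': "at_tuple (out @ colored_words c (word_edges c i w)) rest c i (Suc e) w X s'" for s'
  proof -
    have "fst s' 13 = Suc e" "fst s' 8 = 1" using s' unfolding at_defs by simp_all
    with e
    have "loop_free_wp B (Op Sub 13 13 8) (at_word (out @ colored_words c (word_edges c i w)) rest c i e) s'"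
      using s' by (cases s') (simp add: at_defs)
    from runs_loop_free[OF this] show ?thesis by simp
  qed
  from runs_Seq[OF 1 runs_Seq[OF tuple_loop_runs[OF assms(1-3) space] 3]]
  show ?thesis unfolding word_body_def by (rule runs_mono) simp_all
qed

lemma word_loop_runs:
  assumes "i \<le> g" "c < k * n" "set S \<subseteq> {..<2 ^ b}" "length S < B"
    and space: "length inp + length out +
      3 * length (concat (map (\<lambda>l. word_edges c i (S ! l)) [0..<length S])) < B"
    and s: "at_word out (S @ rest) c i (length S) s"
  shows "runs B (WhileNZ 13 word_body) s (length S * (X * 81 + 11) + 1)
    (at_word (out @ colored_words c (concat (map (\<lambda>l. word_edges c i (S ! l)) [0..<length S])))
      rest c i 0)"
proof -
  let ?w = "\<lambda>l. word_edges c i (S ! l)"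
  let ?I = "\<lambda>m. at_word (out @ colored_words c (concat (map ?w [0..<m])))
     (drop m S @ rest) c i (length S - m)"
  have "runs B (WhileNZ 13 word_body) s (length S * ((X * 81 + 10) + 1) + 1) (?I (length S))"
  proof (rule runs_While[where I = ?I])
    fix m s assume m: "m < length S" and s: "?I m s"
    have s': "at_word (out @ colored_words c (concat (map ?w [0..<m])))
        (S ! m # drop (Suc m) S @ rest) c i (Suc (length S - Suc m)) s"
      using s m by (simp add: Cons_nth_drop_Suc[symmetric] Suc_diff_Suc)
    have "S ! m < 2 ^ b" using assms(3) m nth_mem by blast
    have "runs B word_body s (X * 81 + 10) (at_word ((out @ colored_words c (concat (map ?w [0..<m])))
       @ colored_words c (?w m)) (drop (Suc m) S @ rest) c i (length S - Suc m))"
      by (rule word_body_runs[OF assms(1,2) \<open>S ! m < 2 ^ b\<close> _ _ s'])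
        (use space length_concat_map_upt_prefix[OF m, of ?w] assms(4)
          in \<open>simp_all add: length_colored_words\<close>)
    thus "fst s 13 \<noteq> 0 \<and> runs B word_body s (X * 81 + 10) (?I (Suc m))"
      using s m by (simp add: colored_words_append at_word_def)
  next
    show "?I 0 s" using s by (simp add: colored_words_Nil)
  qed (simp add: at_word_def)
  thus ?thesis by (rule runs_mono) simp_all
qed

text \<open>A component has at most \<open>2 ^ b\<close> words since they are distinct, and each
  word is compared with all \<open>X\<close> tuples.\<close>

definition section_time :: nat where "section_time = 2 ^ b * (X * 81 + 11) + 10"

lemma section_body_runs:
  assumes "i < g" "c < k * n"
    and S: "set (v ! i) \<subseteq> {..<2 ^ b}" "distinct (v ! i)"
    and space: "length inp + length out + 3 * length (section_edges c v i) < B"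
    and s: "at_section out (length (v ! i) # v ! i @ rest) c i s"
  shows "runs B section_body s section_time
    (at_section (out @ colored_words c (section_edges c v i)) rest c (Suc i))"
proof -
  let ?S = "v ! i"
  let ?out = "out @ colored_words c (section_edges c v i)"
  obtain R where s_eq: "s = (R, list_mem (inp @ out))"
    using s unfolding at_defs by (metis prod.collapse)
  have regs: "R 0 = length inp + length out" "R 4 = X" "R 5 = k * n" "R 6 = mid_base" "R 8 = 1"
      "R 9 = k" "R 11 = c" "R 12 = i" "R 16 = c div n" "R 3 = b" "R 7 = 2 ^ b"
      "R (Suc 0) = length inp" "R 2 = n" "R 17 = g" "R 18 = k * n - c"
      "R 19 = g - i" "\<And>r. r \<ge> 30 \<Longrightarrow> R r = 0"
    using s unfolding s_eq at_defs by simp_all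
  have d: "drop (R 10) inp = length ?S # ?S @ rest" using s unfolding s_eq at_defs by simp
  note d' = drop_Cons_imp[OF d] list_mem_append_drop[OF d]
  have p: "Suc (R 10) < B" using d'(1) length_less_B by linarith
  have "length ?S = card (set ?S)" using S(2) by (simp add: distinct_card)
  also have "\<dots> \<le> card {..<2 ^ b :: nat}" using S(1) by (intro card_mono) auto
  finally have len: "length ?S \<le> 2 ^ b" by simp
  hence lenB: "length ?S < B" using small_less_B(6) by linarith
  have "loop_free_wp B (seqs [Load 13 10, Op Add 10 10 8])
     (at_word out (?S @ rest) c i (length ?S)) s"
    unfolding s_eq using p by (simp add: regs d' at_defs)
  note 1 = runs_loop_free[OF this]
  have space': "length inp + length out +
      3 * length (concat (map (\<lambda>l. word_edges c i (?S ! l)) [0..<length ?S])) < B"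
    using space unfolding section_edges_def .
  have 3: "runs B (seqs [Op Add 12 12 8, Op Sub 19 19 8]) s' 3 (at_section ?out rest c (Suc i))"
    if s': "at_word (out @ colored_words c (concat (map (\<lambda>l. word_edges c i (?S ! l)) [0..<length ?S])))
      rest c i 0 s'" for s'
  proof -
    have "at_word ?out rest c i 0 s'" using s' unfolding section_edges_def .
    hence "loop_free_wp B (seqs [Op Add 12 12 8, Op Sub 19 19 8]) (at_section ?out rest c (Suc i)) s'"
      using assms(1) small_less_B(2) by (cases s') (auto simp: at_defs)
    from runs_loop_free[OF this] show ?thesis by (rule runs_mono) simp_all
  qed
  have t: "length ?S * (X * 81 + 11) \<le> 2 ^ b * (X * 81 + 11)" using len by (rule mult_le_mono1)
  have t': "loop_free_cost (seqs [Load 13 10, Op Add 10 10 8]) +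
      (length ?S * (X * 81 + 11) + 1 + 3) \<le> section_time"
    using t unfolding section_time_def seqs.simps loop_free_cost.simps by linarith
  from runs_Seq[OF 1 runs_Seq[OF word_loop_runs[where rest = rest,
      OF less_imp_le[OF assms(1)] assms(2) S(1) lenB space'] 3]]
  show ?thesis unfolding section_body_def by (rule runs_mono[OF _ t'])
qed

abbreviation section_words :: "nat list list \<Rightarrow> nat list" where
  "section_words v \<equiv> concat (map (\<lambda>S. length S # S) v)"

lemma section_loop_runs:
  assumes "v \<in> set W" "c < k * n"
    and space: "length inp + length out + 3 * length (concat (map (section_edges c v) [0..<g])) < B"
    and s: "at_section out (section_words v @ rest) c 0 s"
  shows "runs B (WhileNZ 19 section_body) s (g * (section_time + 1) + 1)
    (at_section (out @ colored_words c (concat (map (section_edges c v) [0..<g]))) rest c g)"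
proof -
  let ?w = "section_edges c v"
  let ?I = "\<lambda>m. at_section (out @ colored_words c (concat (map ?w [0..<m])))
     (section_words (drop m v) @ rest) c m"
  have v: "length v = g" using assms(1) length_vec by simp
  have "runs B (WhileNZ 19 section_body) s (g * (section_time + 1) + 1) (?I g)"
  proof (rule runs_While[where I = ?I])
    fix m s assume m: "m < g" and s: "?I m s"
    have s': "at_section (out @ colored_words c (concat (map ?w [0..<m])))
        (length (v ! m) # v ! m @ section_words (drop (Suc m) v) @ rest) c m s"
      using s m v by (simp add: Cons_nth_drop_Suc[symmetric])
    have "v ! m \<in> set v" using m v by simp
    note vm = words[OF assms(1) this]
    have "runs B section_body s section_time (at_section ((out @ colored_words c (concat (map ?w [0..<m])))
       @ colored_words c (?w m)) (section_words (drop (Suc m) v) @ rest) c (Suc m))"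
      by (rule section_body_runs[OF m assms(2) _ _ _ s'])
        (use space length_concat_map_upt_prefix[OF m, of ?w] vm
          in \<open>simp_all add: length_colored_words\<close>)
    thus "fst s 19 \<noteq> 0 \<and> runs B section_body s section_time (?I (Suc m))"
      using s m by (simp add: colored_words_append at_section_def)
  next
    show "?I 0 s" using s by (simp add: colored_words_Nil)
  qed (simp add: at_section_def)
  thus ?thesis using v by simp
qed

definition color_time :: nat where "color_time = g * (section_time + 1) + 60"

text \<open>The section loop leaves \<open>g\<close> in register 12, so after setting
  \<open>x = 0\<close> the ordinary \<open>emit_prog\<close> writes the pair of the extra
  section.\<close>

lemma color_body_runs:
  assumes c: "c < k * n"
    and space: "length inp + length out + 3 * length (color_edges c) < B"
    and s: "at_color out (section_words (W ! c) @ rest) c s"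
  shows "runs B color_body s color_time
    (at_color (out @ colored_words c (color_edges c)) rest (Suc c))"
proof -
  let ?v = "W ! c"
  let ?e1 = "concat (map (section_edges c ?v) [0..<g])"
  have v: "?v \<in> set W" using c length_W by simp
  have sp: "length inp + length out + 3 * length ?e1 < B"
    "length inp + length (out @ colored_words c ?e1) + 6 < B"
    using space unfolding color_edges_def edge_pair_def by (simp_all add: length_colored_words)
  have cB: "c < B" using c small_less_B(7) by simp
  hence "c div n < B" using div_le_dividend le_less_trans by blast
  hence "loop_free_wp B (seqs [Op Div 16 11 2, Const 12 0, Op Add 19 17 12])
     (at_section out (section_words ?v @ rest) c 0) s"
    using s small_less_B(2) by (cases s) (simp add: at_defs)
  note 1 = runs_loop_free[OF this]
  have 3: "runs B (seqs [Const 15 0, emit_prog, Op Add 11 11 8, Op Sub 18 18 8]) s' 50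
      (at_color (out @ colored_words c (color_edges c)) rest (Suc c))"
    if s': "at_section (out @ colored_words c ?e1) rest c g s'" for s'
  proof -
    let ?out = "out @ colored_words c ?e1"
    obtain R where s_eq: "s' = (R, list_mem (inp @ ?out))"
      using s' unfolding at_defs by (metis prod.collapse)
    have regs: "R 0 = length inp + length ?out" "R 4 = X" "R 5 = k * n" "R 6 = mid_base" "R 8 = 1"
        "R 9 = k" "R 11 = c" "R 12 = g" "R 16 = c div n" "R 3 = b" "R 7 = 2 ^ b"
        "R (Suc 0) = length inp" "R 2 = n" "R 17 = g" "R 18 = k * n - c"
        "drop (R 10) inp = rest" "\<And>r. r \<ge> 30 \<Longrightarrow> R r = 0"
      using s' unfolding s_eq at_defs by simp_all
    define R' where "R' = R(15 := 0)"
    have e: "loop_free_wp B emit_prog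
      (\<lambda>(R'', M'). M' = list_mem (inp @ ?out @ colored_words c (edge_pair g 0 c)) \<and> R'' 0 = R' 0 + 6 \<and>
       (\<forall>r. r \<noteq> 0 \<longrightarrow> r \<notin> {21..25} \<longrightarrow> R'' r = R' r)) (R', list_mem (inp @ ?out))"
      by (rule emit_prog_runs[OF _ X_pos c]) (use regs sp in \<open>auto simp: R'_def\<close>)
    have l6: "length (colored_words c (edge_pair g 0 c)) = 6"
      by (simp add: length_colored_words edge_pair_def)
    have bd: "Suc c < B" "k * n - Suc c < B" using c small_less_B(7) by linarith+
    have "loop_free_wp B (seqs [Const 15 0, emit_prog, Op Add 11 11 8, Op Sub 18 18 8])
       (at_color (out @ colored_words c (color_edges c)) rest (Suc c)) s'"
      unfolding s_eq using small_less_B(8)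
      apply (simp add: regs)
      apply (rule loop_free_wp_mono[OF e[unfolded R'_def append_assoc]])
      subgoal for s'' using bd
        by (cases s'') (simp add: at_defs color_edges_def colored_words_append regs l6)
      done
    from runs_loop_free[OF this] show ?thesis
      by (rule runs_mono) (simp_all add: emit_prog_def append_reg_def)
  qed
  from runs_Seq[OF 1 runs_Seq[OF section_loop_runs[OF v c sp(1)] 3]]
  show ?thesis unfolding color_body_def color_time_def by (rule runs_mono) simp_all
qed

definition edge_words :: "nat list" where
  "edge_words = concat (map (\<lambda>c. colored_words c (color_edges c)) [0..<k * n])"

lemma length_edge_words: "length edge_words = 3 * length all_edges"
proof -
  have "length (concat (map (\<lambda>c. colored_words c (color_edges c)) [0..<m])) =
      3 * length (concat (map color_edges [0..<m]))" for m
    by (induction m) (auto simp: length_colored_words)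
  thus ?thesis unfolding edge_words_def all_edges_def by simp
qed

lemma color_loop_runs:
  assumes out: "length out = 5"
    and s: "at_color out stream 0 s"
  shows "runs B (WhileNZ 18 color_body) s (k * n * (color_time + 1) + 1)
    (at_color (out @ edge_words) [] (k * n))"
proof -
  let ?w = "\<lambda>c. colored_words c (color_edges c)"
  let ?I = "\<lambda>m. at_color (out @ concat (map ?w [0..<m])) (section_words (concat (drop m W))) m"
  have "runs B (WhileNZ 18 color_body) s (k * n * (color_time + 1) + 1) (?I (k * n))"
  proof (rule runs_While[where I = ?I])
    fix m s assume m: "m < k * n" and s: "?I m s"
    have s': "at_color (out @ concat (map ?w [0..<m]))
        (section_words (W ! m) @ section_words (concat (drop (Suc m) W))) m s"
      using s m length_W by (simp add: Cons_nth_drop_Suc[symmetric])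
    have "runs B color_body s color_time (at_color ((out @ concat (map ?w [0..<m]))
       @ ?w m) (section_words (concat (drop (Suc m) W))) (Suc m))"
      by (rule color_body_runs[OF m _ s'])
        (use length_less_B length_edge_words out length_concat_map_upt_prefix[OF m, of ?w]
          in \<open>simp add: length_colored_words edge_words_def\<close>)
    thus "fst s 18 \<noteq> 0 \<and> runs B color_body s color_time (?I (Suc m))"
      using s m by (simp add: at_color_def)
  next
    show "?I 0 s" using s by (simp add: stream_def)
  qed (simp add: at_color_def)
  thus ?thesis using length_W by (simp add: edge_words_def)
qed

text \<open>The argument is the edge count: 0 as placeholder until \<open>finish_prog\<close> fills
  in the true value.\<close>

definition header :: "nat \<Rightarrow> nat list" where
  "header m = [vertex_number, m, k * n, 0, dest]"

lemma header_prog_runs: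
  "runs B (header_prog k) (init_state inp) 50 (at_color (header 0) stream 0)"
proof -
  have m: "list_mem inp 0 = n" "list_mem inp (Suc 0) = g" "list_mem inp 2 = b"
    unfolding inp_def list_mem_def by simp_all
  have le: "g * k + k + 1 \<le> mid_base" "(g * k + k) * X \<le> mid_base" 
    unfolding mid_base_def using mult_le_mono2[of 1 X "g * k + k + 1"] X_pos by simp_all
  have bd: "Suc (g * k + k) < B" "(g * k + k) * X < B" "Suc (g * k + k) * X = mid_base"
    using le small_less_B(9) unfolding mid_base_def by simp_all
  have "vertex_number = mid_base + (Suc g * X * (k * n)) + 2 ^ g"
    unfolding vertex_number_def by simp
  note vn = this[symmetric]
  have "Suc g * 1 \<le> (g * k + k + 1) * X"
    using k_ge_2 X_pos by (intro mult_mono) (auto simp: trans_le_add1)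
  hence bd2: "Suc g < B" using small_less_B(9) unfolding mid_base_def mult_1_right by (rule le_less_trans)
  have "Suc g * X \<le> (g * k + k + 1) * X"
    using k_ge_2 by (intro mult_le_mono1) (auto simp: trans_le_add1)
  hence bd3: "Suc g * X < B" using small_less_B(9) unfolding mid_base_def by (rule le_less_trans)
  have bd4: "mid_base + Suc g * X * (k * n) < B" "Suc g * X * (k * n) < B" "2 ^ g < B"
    using vertex_number_less_B vn by linarith+
  have Xl: "X + 3 \<le> length inp" unfolding inp_def using length_tt by (simp add: X_def)
  have len: "length inp + 5 < B" "X + 3 < B" using length_less_B Xl by linarith+
  have st: "drop (X + 3) inp = stream" unfolding inp_def using length_tt by (simp add: X_def numeral_3_eq_3)
  have pb: "push_bit m (Suc 0) = 2 ^ m" for m by (simp add: push_bit_eq_mult)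
  have "loop_free_wp B (header_prog k) (at_color (header 0) stream 0) (init_state inp)"
    unfolding header_prog_def append_reg_def init_state_list_mem
    using bd bd2 bd3 bd4 len small_less_B vertex_number_less_B
    by (simp add: m pb X_def[symmetric] at_defs header_def dest_def bd(3) vn list_mem_append5
      st add.commute[of 3] del: mult_Suc)
  from runs_loop_free[OF this] show ?thesis
    by (rule runs_mono) (simp_all add: header_prog_def append_reg_def)
qed

text \<open>Moving upwards is safe because a source cell lies above its destination and has not been
  overwritten. Cells beyond \<open>xs\<close> deliver 0, so \<open>length xs\<close> moves also
  erase the remains of the input.\<close>

definition moved :: "nat list \<Rightarrow> nat \<Rightarrow> nat \<Rightarrow> state \<Rightarrow> bool" where
  "moved xs l m s \<longleftrightarrow>
     snd s = (\<lambda>a. if a < m then list_mem xs (a + length inp) else list_mem xs a) \<and>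
     fst s 22 = m \<and> fst s 23 = length xs - m \<and> fst s 1 = length inp \<and> fst s 8 = 1 \<and>
     fst s 21 = l \<and> (\<forall>r\<ge>30. fst s r = 0)"

lemma move_loop_runs:
  assumes "length inp + length xs < B" "moved xs l 0 s"
  shows "runs B (WhileNZ 23 move_body) s (length xs * 7 + 1) (moved xs l (length xs))"
proof -
  have "runs B (WhileNZ 23 move_body) s (length xs * (6 + 1) + 1) (moved xs l (length xs))"
  proof (rule runs_While[where I = "moved xs l"])
    fix m s assume m: "m < length xs" and s: "moved xs l m s"
    obtain R where s_eq: "s = (R, (\<lambda>a. if a < m then list_mem xs (a + length inp) else list_mem xs a))"
      using s unfolding moved_def by (metis prod.collapse)
    have regs: "R 22 = m" "R 23 = length xs - m" "R (Suc 0) = length inp" "R 8 = 1" "R 21 = l"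
      "\<And>r. r \<ge> 30 \<Longrightarrow> R r = 0" using s unfolding s_eq moved_def by simp_all
    have bd: "m + length inp < B" "Suc m < B" "length xs - Suc m < B" using m assms(1) by linarith+
    have pos: "length inp > 0" unfolding inp_def by simp
    have M: "(\<lambda>a. if a < m then list_mem xs (a + length inp) else list_mem xs a)
       (m := list_mem xs (m + length inp)) =
       (\<lambda>a. if a < Suc m then list_mem xs (a + length inp) else list_mem xs a)"
      by (auto simp: fun_eq_iff less_Suc_eq)
    have "loop_free_wp B move_body (moved xs l (Suc m)) s"
      unfolding s_eq move_body_def using pos by (simp add: regs moved_def M bd)
    from runs_loop_free[OF this] have "runs B move_body s 6 (moved xs l (Suc m))"
      by (rule runs_mono) (simp_all add: move_body_def)
    thus "fst s 23 \<noteq> 0 \<and> runs B move_body s 6 (moved xs l (Suc m))"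
      using m s by (simp add: moved_def)
  qed (use assms in \<open>simp_all add: moved_def\<close>)
  thus ?thesis by simp
qed

text \<open>The postcondition is an equation between whole states, since the program run next is
  specified from \<open>init_state\<close> only. The edge count comes from the output length: five
  header words, three words per edge.\<close>

lemma finish_prog_runs:
  assumes s: "at_color (header 0 @ edge_words) rest c s"
  shows "runs B finish_prog s (7 * (length inp + 5 + 3 * length all_edges) + 60)
    (\<lambda>s'. s' = init_state (header (length all_edges) @ edge_words))"
proof -
  let ?out = "header 0 @ edge_words" and ?out' = "header (length all_edges) @ edge_words"
  obtain R where s_eq: "s = (R, list_mem (inp @ ?out))"
    using s unfolding at_defs by (metis prod.collapse)
  have len: "length ?out = 5 + 3 * length all_edges" "length ?out' = 5 + 3 * length all_edges"
    by (simp_all add: header_def length_edge_words)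
  have regs: "R 0 = length inp + (5 + 3 * length all_edges)" "R (Suc 0) = length inp" "R 8 = 1"
    "\<And>r. r \<ge> 30 \<Longrightarrow> R r = 0"
    using s unfolding s_eq at_defs len by simp_all
  \<comment> \<open>Cell \<open>length inp + 1\<close> is the second word of the header, where the
    edge count belongs.\<close>
  have M: "(list_mem (inp @ ?out))(Suc (length inp) := length all_edges) = list_mem (inp @ ?out')"
    by (auto simp: fun_eq_iff list_mem_def header_def nth_append nth_Cons split: nat.splits)
  have bd: "length inp + (5 + 3 * length all_edges) < B" "5 + 3 * length all_edges < B"
    "Suc (length inp) < B" "3 * length all_edges < B" "length all_edges < B"
    using length_less_B small_less_B(8) by linarith+
  have "loop_free_wp B (seqs [Op Sub 21 0 1, Const 22 5, Op Sub 22 21 22, Const 23 3, Op Div 22 22 23,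
       Op Add 24 1 8, Store 24 22, Const 22 0, Op Add 23 0 22]) (moved (inp @ ?out') (length ?out') 0) s"
    unfolding s_eq using bd small_less_B(8) len by (simp add: regs moved_def M)
  note 1 = runs_loop_free[OF this]
  have 2: "length inp + length (inp @ ?out') < B" using length_less_B len by simp
  have 3: "runs B (seqs (Const 22 0 # Op Add 0 21 22 # map (\<lambda>r. Const r 0) [1..<30])) s' 40
     (\<lambda>s'. s' = init_state ?out')"
    if s': "moved (inp @ ?out') (length ?out') (length (inp @ ?out')) s'" for s'
  proof -
    obtain R M where s_eq: "s' = (R, M)" by force
    have M: "M = list_mem ?out'"
      using s' unfolding s_eq moved_def by (auto simp: fun_eq_iff list_mem_def nth_append)
    have regs: "R 21 = length ?out'" "\<And>r. r \<ge> 30 \<Longrightarrow> R r = 0"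
      using s' unfolding s_eq moved_def by simp_all
    have "loop_free_wp B (seqs (map (\<lambda>r. Const r 0) [1..<30])) (\<lambda>s'. s' = init_state ?out')
        (R(22 := 0, 0 := length ?out'), M)"
      by (rule loop_free_wp_clear) (use small_less_B(8) regs in
         \<open>auto simp: init_state_list_mem M fun_eq_iff\<close>)
    hence "loop_free_wp B (seqs (Const 22 0 # Op Add 0 21 22 # map (\<lambda>r. Const r 0) [1..<30]))
       (\<lambda>s'. s' = init_state ?out') s'"
      unfolding s_eq using bd len small_less_B(8) by (simp add: regs(1) del: upt_Suc)
    from runs_loop_free[OF this] show ?thesis
      by (rule runs_mono) (simp_all add: loop_free_cost_clear)
  qed
  from runs_Seq[OF 1 runs_Seq[OF move_loop_runs[OF 2] 3]] show ?thesis
    unfolding finish_prog_def by (rule runs_mono) (simp_all add: header_def length_edge_words)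
qed

lemma reduction_prog_runs:
  "runs B (reduction_prog k) (init_state inp)
     (k * n * (color_time + 1) + 7 * (length inp + 5 + 3 * length all_edges) + 120)
     (\<lambda>s'. s' = init_state (header (length all_edges) @ edge_words))"
proof -
  have h: "length (header 0) = 5" by (simp add: header_def)
  from runs_Seq[OF header_prog_runs runs_Seq[OF color_loop_runs[OF h] finish_prog_runs]]
  show ?thesis unfolding reduction_prog_def by (rule runs_mono) simp_all
qed

end

section \<open>Counting the paths of the graph\<close>

text \<open>Finiteness is included because \<open>card\<close> is 0 on infinite sets, so
  cardinalities alone could not be added over successors.\<close>

definition path_count :: "('v \<times> 'v) set \<Rightarrow> 'v \<Rightarrow> 'v \<Rightarrow> nat \<Rightarrow> bool" where
  "path_count E u t N \<longleftrightarrow>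
     finite {p. is_st_path E u t p} \<and> card {p. is_st_path E u t p} = N"

lemma path_edges_conv_nth: "path_edges p = {(p ! l, p ! Suc l) |l. Suc l < length p}"
  unfolding path_edges_def set_zip by (auto simp: nth_tl)

lemma path_count_target:
  assumes "{v. (t, v) \<in> E} = {}"
  shows "path_count E t t 1"
proof -
  have "is_st_path E t t p \<longleftrightarrow> p = [t]" for p
  proof (cases p)
    case (Cons u q)
    thus ?thesis using assms unfolding is_st_path_def by (cases q) auto
  qed (simp add: is_st_path_def)
  hence "{p. is_st_path E t t p} = {[t]}" by auto
  thus ?thesis unfolding path_count_def by simp
qed

text \<open>As \<open>u\<close> is not the target, no path consists of \<open>u\<close> alone, and
  removing the first vertex splits the paths by their second one.\<close>

lemma path_count_step:
  assumes "u \<noteq> t" and V: "V = {v. (u, v) \<in> E}"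
    and N: "\<And>v. v \<in> V \<Longrightarrow> path_count E v t (N v)" and "finite V"
  shows "path_count E u t (\<Sum>v\<in>V. N v)"
proof -
  let ?P = "\<lambda>v. {p. is_st_path E v t p}"
  have "is_st_path E u t p \<longleftrightarrow> (\<exists>v\<in>V. \<exists>q. p = u # q \<and> is_st_path E v t q)" for p
  proof (cases p)
    case (Cons w q)
    thus ?thesis using assms(1,2) unfolding is_st_path_def by (cases q) auto
  qed (simp add: is_st_path_def)
  hence P: "?P u = (\<Union>v\<in>V. (#) u ` ?P v)" by auto
  have "card (?P u) = (\<Sum>v\<in>V. card ((#) u ` ?P v))"
    unfolding P using N \<open>finite V\<close> unfolding path_count_def
    by (intro card_UN_disjoint) (auto simp: is_st_path_def)
  also have "\<dots> = (\<Sum>v\<in>V. N v)"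
    using N unfolding path_count_def by (intro sum.cong refl) (simp add: card_image)
  finally show ?thesis using N \<open>finite V\<close> unfolding path_count_def P by blast
qed

context reduction
begin

section \<open>The edges of the graph: colors, distinctness, acyclicity\<close>

definition valid :: "nat \<Rightarrow> nat \<Rightarrow> nat \<Rightarrow> bool" where
  "valid i x c \<longleftrightarrow> c < k * n \<and>
     (i < g \<and> x < X \<and> tt ! x \<noteq> 0 \<and> x div 2 ^ (c div n * b) mod 2 ^ b \<in> set (W ! c ! i) \<or>
      i = g \<and> x = 0)"

lemma validD: "valid i x c \<Longrightarrow> i \<le> g \<and> x < X \<and> c < k * n \<and> c div n < k \<and> n > 0"
  using X_pos color_div_less unfolding valid_def by (cases n) auto

lemma set_color_edges:
  "c < k * n \<Longrightarrow> set (color_edges c) = (\<Union>(i, x) \<in> {(i, x). valid i x c}. set (edge_pair i x c))"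
proof -
  assume c: "c < k * n"
  have w: "set (word_edges c i w) = (\<Union>x \<in> {x. x < X \<and> tt ! x \<noteq> 0 \<and>
      x div 2 ^ (c div n * b) mod 2 ^ b = w}. set (edge_pair i x c))" for i w
    unfolding word_edges_def tuple_edges_def by (auto split: if_splits)
  have "set (section_edges c (W ! c) i) = (\<Union>w \<in> set (W ! c ! i). set (word_edges c i w))" for i
    unfolding section_edges_def by (force simp: set_conv_nth[of "W ! c ! i"])
  hence "set (color_edges c) =
      (\<Union>i<g. \<Union>w \<in> set (W ! c ! i). set (word_edges c i w)) \<union> set (edge_pair g 0 c)"
    unfolding color_edges_def by auto
  also have "\<dots> = (\<Union>(i, x) \<in> {(i, x). valid i x c}. set (edge_pair i x c))"
    unfolding w valid_def using c by auto
  finally show ?thesis .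
qed

lemma mid_inj:
  assumes "mid i x c = mid i' x' c'" "x < X" "x' < X" "c < k * n" "c' < k * n"
  shows "i = i' \<and> x = x' \<and> c = c'"
proof -
  have 1: "(i * X + x) * (k * n) + c = (i' * X + x') * (k * n) + c'"
    using assms(1) unfolding mid_def by simp
  from arg_cong[OF this, of "\<lambda>u. u mod (k * n)"] assms have c: "c = c'" by simp
  have "k * n \<noteq> 0" using assms(4) by linarith
  hence "i * X + x = i' * X + x'" using 1 unfolding c add_right_cancel mult_cancel2 by argo
  from arg_cong[OF this, of "\<lambda>u. u mod X"] arg_cong[OF this, of "\<lambda>u. u div X"] c assms
  show ?thesis by simp
qed

lemma edge_color_pair:
  assumes "valid i x c" "e \<in> set (edge_pair i x c)"
  shows "edge_color e = c"
proof -
  have v: "i \<le> g" "x < X" "c < k * n" "c div n < k" using validD[OF assms(1)] by auto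
  have "max (fst e) (snd e) = mid i x c"
    using assms(2) node_less[OF v(1,2,4)] unfolding edge_pair_def mid_def by auto
  thus ?thesis unfolding edge_color_def mid_def using v by simp
qed

text \<open>The program writes the color from its loop counter, the encoding of the graph computes
  it from the edge; here the two are reconciled.\<close>

lemma edge_words_eq:
  "concat (map (\<lambda>c. colored_words c (color_edges c)) [0..<k * n]) =
     concat (map (\<lambda>e. [fst e, snd e, edge_color e]) all_edges)"
proof -
  have "colored_words c (color_edges c) = concat (map (\<lambda>e. [fst e, snd e, edge_color e]) (color_edges c))"
    if "c < k * n" for c
    unfolding colored_words_def
    by (intro arg_cong[of _ _ concat] map_cong refl) (use that edge_color_pair in \<open>auto simp: set_color_edges\<close>)
  hence "concat (map (\<lambda>c. colored_words c (color_edges c)) [0..<k * n]) =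
      concat (map (\<lambda>c. concat (map (\<lambda>e. [fst e, snd e, edge_color e]) (color_edges c))) [0..<k * n])"
    by (intro arg_cong[of _ _ concat] map_cong refl) simp
  moreover have "concat (map h (concat (map f xs))) = concat (map (\<lambda>c. concat (map h (f c))) xs)"
    for h :: "nat \<times> nat \<Rightarrow> nat list" and f :: "nat \<Rightarrow> (nat \<times> nat) list" and xs
    by (induction xs) auto
  ultimately show ?thesis unfolding all_edges_def by simp
qed

lemma edges_graph: "edges graph = {e. \<exists>i x c. valid i x c \<and> e \<in> set (edge_pair i x c)}"
proof -
  have "edges graph = (\<Union>c<k * n. set (color_edges c))"
    unfolding edges_def graph_def all_edges_def by auto
  also have "\<dots> = (\<Union>c<k * n. \<Union>(i, x) \<in> {(i, x). valid i x c}. set (edge_pair i x c))"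
    using set_color_edges by simp
  also have "\<dots> = {e. \<exists>i x c. valid i x c \<and> e \<in> set (edge_pair i x c)}"
    using validD by blast
  finally show ?thesis .
qed

lemma edge_pair_disjoint:
  assumes "x < X" "x' < X" "c < k * n" "c' < k * n" "(i, x, c) \<noteq> (i', x', c')" "i \<le> g" "i' \<le> g"
  shows "set (edge_pair i x c) \<inter> set (edge_pair i' x' c') = {}"
proof -
  have "mid i x c \<noteq> mid i' x' c'" using mid_inj[of i x c i' x' c'] assms by auto
  moreover have "node (i * k + c div n) x < mid_base" "node (i' * k + c' div n) x' < mid_base"
    using node_less assms color_div_less by simp_all
  ultimately show ?thesis unfolding edge_pair_def mid_def by auto
qed

text \<open>Different colors are told apart by \<open>edge_color\<close>, different sections and
  tuples by the middle vertex. Different words of one component select disjoint sets of tuples, as a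
  tuple has only one component \<open>c div n\<close>.\<close>

lemma distinct_all_edges: "distinct all_edges"
  unfolding all_edges_def
proof (rule distinct_concat_map_upt)
  fix c assume c: "c < k * n"
  let ?v = "W ! c"
  have v: "?v \<in> set W" using c length_W by simp
  have te: "set (tuple_edges c i w x) \<subseteq> set (edge_pair i x c)" for i w x
    unfolding tuple_edges_def by auto
  \<comment> \<open>The condition on \<open>w\<close> is kept because it separates the words of a
    component below.\<close>
  have we: "set (word_edges c i w) \<subseteq>
      (\<Union>x \<in> {x. x < X \<and> x div 2 ^ (c div n * b) mod 2 ^ b = w}. set (edge_pair i x c))" for i w
    unfolding word_edges_def tuple_edges_def by (auto split: if_splits)
  have se: "set (section_edges c ?v i) \<subseteq> (\<Union>x<X. set (edge_pair i x c))" for i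
    using we unfolding section_edges_def set_concat set_map by blast
  have dp: "distinct (edge_pair i x c)" if "i \<le> g" "x < X" for i x
    using node_less[OF that color_div_less[OF c]] unfolding edge_pair_def mid_def by auto
  have disj: "set (edge_pair i x c) \<inter> set (edge_pair i' x' c) = {}"
    if "x < X" "x' < X" "i \<le> g" "i' \<le> g" "i \<noteq> i' \<or> x \<noteq> x'" for i i' x x'
    using edge_pair_disjoint[OF that(1,2) c c] that by auto
  have dw: "distinct (word_edges c i w)" if "i \<le> g" for i w
    unfolding word_edges_def
  proof (rule distinct_concat_map_upt)
    fix x x' assume "x < X" "x' < X" "x \<noteq> x'"
    thus "set (tuple_edges c i w x) \<inter> set (tuple_edges c i w x') = {}"
      using te[of i w x] te[of i w x'] disj[of x x' i i] that by blast
  qed (use dp that in \<open>auto simp: tuple_edges_def\<close>)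
  have ds: "distinct (section_edges c ?v i)" if i: "i < g" for i
    unfolding section_edges_def
  proof (rule distinct_concat_map_upt)
    fix l l' assume l: "l < length (?v ! i)" "l' < length (?v ! i)" "l \<noteq> l'"
    have "?v ! i \<in> set ?v" using i length_vec[OF v] by simp
    hence "?v ! i ! l \<noteq> ?v ! i ! l'" using words[OF v] l nth_eq_iff_index_eq by blast
    moreover have "\<exists>x. x < X \<and> x div 2 ^ (c div n * b) mod 2 ^ b = w \<and> e \<in> set (edge_pair i x c)"
      if "e \<in> set (word_edges c i w)" for e w using we that by blast
    ultimately show "set (word_edges c i (?v ! i ! l)) \<inter> set (word_edges c i (?v ! i ! l')) = {}"
      using disj[of _ _ i i] less_imp_le[OF i] by (metis disjoint_iff)
  qed (use dw i in auto)
  have "distinct (concat (map (section_edges c ?v) [0..<g]))"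
  proof (rule distinct_concat_map_upt)
    fix i i' assume "i < g" "i' < g" "i \<noteq> i'"
    hence "set (edge_pair i x c) \<inter> set (edge_pair i' x' c) = {}" if "x < X" "x' < X" for x x'
      using disj that by simp
    thus "set (section_edges c ?v i) \<inter> set (section_edges c ?v i') = {}"
      using se[of i] se[of i'] by blast
  qed (use ds in auto)
  moreover have "set (section_edges c ?v i) \<inter> set (edge_pair g 0 c) = {}" if "i < g" for i
  proof -
    have "set (edge_pair i x c) \<inter> set (edge_pair g 0 c) = {}" if "x < X" for x
      using disj[of x 0 i g] that X_pos \<open>i < g\<close> by simp
    thus ?thesis using se[of i] by blast
  qed
  ultimately show "distinct (color_edges c)"
    unfolding color_edges_def using dp[of g 0] X_pos by (auto simp: disjoint_iff)
next
  fix c c' assume c: "c < k * n" "c' < k * n" "c \<noteq> c'"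
  have "edge_color e = c" if "e \<in> set (color_edges c)" "c < k * n" for e c
    using that(1) edge_color_pair unfolding set_color_edges[OF that(2)] by blast
  with c show "set (color_edges c) \<inter> set (color_edges c') = {}" by blast
qed

text \<open>The position along a path: every edge increases it by exactly 1.\<close>

definition potential :: "nat \<Rightarrow> nat" where
  "potential u = (if u < mid_base then 2 * (u div X) else
     2 * ((u - mid_base) div (k * n) div X * k + (u - mid_base) mod (k * n) div n) + 1)"

lemma node_div: "x < X \<Longrightarrow> node q x div X = q"
  unfolding node_def by simp

lemma node_mod: "x < X \<Longrightarrow> node q x mod X = (if k dvd q then 0 else x)"
  unfolding node_def by simp

lemma potential_mid: "x < X \<Longrightarrow> c < k * n \<Longrightarrow> potential (mid i x c) = 2 * (i * k + c div n) + 1"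
  unfolding potential_def mid_def using mult_add_div[of c "k * n"] mult_add_mod[of c "k * n"]
  by (simp del: mult_eq_0_iff)

lemma potential_node:
  "x < X \<Longrightarrow> node q x < mid_base \<Longrightarrow> potential (node q x) = 2 * q"
  unfolding potential_def by (simp add: node_div)

lemma edges_cases:
  assumes "(u, v) \<in> edges graph"
  obtains (out) i x c where "valid i x c" "u = node (i * k + c div n) x" "v = mid i x c"
  | (ret) i x c where "valid i x c" "u = mid i x c" "v = node (i * k + c div n + 1) x"
  using assms unfolding edges_graph edge_pair_def by auto

lemma potential_edge:
  assumes "(u, v) \<in> edges graph"
  shows "potential v = Suc (potential u)"
  using assms
proof (cases rule: edges_cases)
  case (out i x c)
  note v = validD[OF out(1)]
  show ?thesis using v node_less[of i x "c div n"] by (simp add: out potential_mid potential_node)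
next
  case (ret i x c)
  note v = validD[OF ret(1)]
  show ?thesis using v node_less[of i x "c div n"]
    by (simp add: ret potential_mid potential_node del: Suc_eq_plus1)
qed

lemma acyclic_edges: "acyclic (edges graph)"
proof (rule acyclic_subset[OF wf_acyclic[OF wf_measure]])
  show "edges graph \<subseteq> measure potential" using potential_edge by auto
qed

lemma source_eq: "node 0 0 = 0" unfolding node_def by simp

lemma dest_eq: "node ((g + 1) * k) x = dest"
  unfolding node_def dest_def by (simp add: algebra_simps)

lemma graph_instance: "graph \<in> elst_instances"
proof -
  have "u < vertex_number \<and> v < vertex_number \<and> edge_color (u, v) < k * n" if uv: "(u, v) \<in> edges graph" for u v
  proof -
    obtain i x c where ixc: "valid i x c" "(u, v) \<in> set (edge_pair i x c)"
      using uv unfolding edges_graph by blast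
    note v = validD[OF ixc(1)]
    thus ?thesis using edge_color_pair[OF ixc] ixc(2) node_less[of i x "c div n"] mid_less[of i x c] mid_base_le
      unfolding edge_pair_def by auto
  qed
  moreover have "dest < vertex_number" using dest_le mid_base_le by simp
  ultimately show ?thesis
    using acyclic_edges distinct_all_edges unfolding elst_instances_def
    by (auto simp: graph_def colors_def)
qed

text \<open>A choice of one color per block, listed by block, so that \<open>cs ! j\<close> is the
  color usable in step \<open>j\<close> of each section.\<close>

definition transversals :: "nat list set" where
  "transversals = {cs. length cs = k \<and> (\<forall>j<k. cs ! j < k * n \<and> cs ! j div n = j)}"

definition restricted_edges :: "nat list \<Rightarrow> (nat \<times> nat) set" where
  "restricted_edges cs = {e \<in> edges graph. edge_color e \<in> set cs}"

definition section_count :: "nat list \<Rightarrow> nat \<Rightarrow> nat" where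
  "section_count cs i = card {x. \<forall>j<k. valid i x (cs ! j)}"

lemma transversal_mem:
  assumes "cs \<in> transversals" "c \<in> set cs"
  shows "c < k * n" "c div n < k" "cs ! (c div n) = c"
  using assms unfolding transversals_def by (auto simp: in_set_conv_nth)

section \<open>Counting the paths for a fixed transversal\<close>

context
  fixes cs assumes cs: "cs \<in> transversals"
begin

text \<open>At \<open>j = 0\<close> the node has forgotten its tuple and any valid one may be
  chosen; afterwards the tuple is fixed. Only color \<open>cs ! j\<close> is available, as no other
  member of \<open>cs\<close> lies in block \<open>j\<close>.\<close>

lemma successors_node:
  assumes "i \<le> g" "j < k" "y < X"
  shows "{v. (node (i * k + j) y, v) \<in> restricted_edges cs} =
    (\<lambda>x. mid i x (cs ! j)) ` {x. valid i x (cs ! j) \<and> (j = 0 \<or> x = y)}"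
proof -
  have csj: "cs ! j \<in> set cs" "cs ! j div n = j" using cs assms(2) unfolding transversals_def by auto
  have dvd: "k dvd i * k + j \<longleftrightarrow> j = 0" using assms(2)
    by (metis dvd_add_right_iff dvd_triv_right gcd_nat.extremum nat_dvd_not_less neq0_conv)
  show ?thesis
  proof (intro set_eqI iffI)
    fix v assume "v \<in> {v. (node (i * k + j) y, v) \<in> restricted_edges cs}"
    hence e: "(node (i * k + j) y, v) \<in> edges graph" and
      col: "edge_color (node (i * k + j) y, v) \<in> set cs"
      unfolding restricted_edges_def by auto
    from e show "v \<in> (\<lambda>x. mid i x (cs ! j)) ` {x. valid i x (cs ! j) \<and> (j = 0 \<or> x = y)}"
    proof (cases rule: edges_cases)
      case (out i' x c)
      note v = validD[OF out(1)]
      have "edge_color (node (i * k + j) y, v) = c"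
        by (rule edge_color_pair[OF out(1)]) (simp add: out edge_pair_def)
      hence c: "c \<in> set cs" using col by simp
      have q: "i * k + j = i' * k + c div n"
        using arg_cong[OF out(2), of "\<lambda>u. u div X"] assms v by (simp add: node_div)
      have "i = i'" using arg_cong[OF q, of "\<lambda>u. u div k"] assms(2) v by simp
      moreover have j: "j = c div n" using q calculation by simp
      moreover have "c = cs ! j" using transversal_mem(3)[OF cs c] j by simp
      moreover have "j = 0 \<or> x = y"
        using arg_cong[OF out(2), of "\<lambda>u. u mod X"] assms v q dvd by (auto simp: node_mod)
      ultimately show ?thesis using out by auto
    next
      case (ret i' x c)
      thus ?thesis using node_less(1)[OF assms(1,3,2)] unfolding mid_def by simp
    qed
  next
    fix v assume "v \<in> (\<lambda>x. mid i x (cs ! j)) ` {x. valid i x (cs ! j) \<and> (j = 0 \<or> x = y)}"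
    then obtain x where x: "valid i x (cs ! j)" "j = 0 \<or> x = y" "v = mid i x (cs ! j)" by auto
    have "node (i * k + j) y = node (i * k + j) x" using x(2) dvd unfolding node_def by auto
    hence m: "(node (i * k + j) y, v) \<in> set (edge_pair i x (cs ! j))"
      unfolding edge_pair_def x(3) csj by simp
    show "v \<in> {v. (node (i * k + j) y, v) \<in> restricted_edges cs}"
      using m x(1) edge_color_pair[OF x(1) m] csj unfolding restricted_edges_def edges_graph by auto
  qed
qed

lemma successors_mid:
  assumes "valid i x c" "c \<in> set cs"
  shows "{v. (mid i x c, v) \<in> restricted_edges cs} = {node (i * k + c div n + 1) x}"
proof (intro set_eqI iffI)
  fix v assume "v \<in> {v. (mid i x c, v) \<in> restricted_edges cs}"
  hence e: "(mid i x c, v) \<in> edges graph" unfolding restricted_edges_def by auto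
  from e show "v \<in> {node (i * k + c div n + 1) x}"
  proof (cases rule: edges_cases)
    case (out i' x' c')
    thus ?thesis using node_less(1)[of i' x' "c' div n"] validD[OF out(1)] unfolding mid_def by simp
  next
    case (ret i' x' c')
    thus ?thesis using mid_inj[OF ret(2)] validD[OF ret(1)] validD[OF assms(1)] by simp
  qed
next
  fix v assume "v \<in> {node (i * k + c div n + 1) x}"
  hence m: "(mid i x c, v) \<in> set (edge_pair i x c)" unfolding edge_pair_def by simp
  show "v \<in> {v. (mid i x c, v) \<in> restricted_edges cs}"
    using m assms edge_color_pair[OF assms(1) m] unfolding restricted_edges_def edges_graph by auto
qed

lemma successors_dest: "{v. (dest, v) \<in> restricted_edges cs} = {}"
proof -
  have False if "(dest, v) \<in> edges graph" for v
    using that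
  proof (cases rule: edges_cases)
    case (out i x c)
    note v = validD[OF out(1)]
    have "(g + 1) * k = i * k + c div n"
      using arg_cong[OF out(2), of "\<lambda>u. u div X"] v X_pos dest_eq[of 0] node_div[of 0 "(g + 1) * k"]
      by (simp add: node_div)
    moreover have "i * k \<le> g * k" using v by simp
    ultimately show False using v by simp
  next
    case (ret i x c)
    thus ?thesis using dest_le X_pos unfolding mid_def by simp
  qed
  thus ?thesis unfolding restricted_edges_def by auto
qed

lemma path_count_mid:
  assumes "valid i x c" "c \<in> set cs"
    and "path_count (restricted_edges cs) (node (i * k + c div n + 1) x) dest N"
  shows "path_count (restricted_edges cs) (mid i x c) dest N"
proof -
  have "mid i x c \<noteq> dest" using dest_le X_pos unfolding mid_def by simp
  from path_count_step[OF this successors_mid[OF assms(1,2), symmetric], of "\<lambda>_. N"] assms(3)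
  show ?thesis by simp
qed

text \<open>From \<open>j = 1\<close> on the tuple is fixed, so a node has at most one successor:
  going backwards, the count is handed on or drops to 0.\<close>

lemma path_count_node:
  assumes "i \<le> g" "x < X"
    and N: "path_count (restricted_edges cs) (node ((i + 1) * k) 0) dest N"
    and "j \<le> k" "1 \<le> j"
  shows "path_count (restricted_edges cs) (node (i * k + j) x) dest
     (if \<forall>j'\<in>{j..<k}. valid i x (cs ! j') then N else 0)"
  using \<open>j \<le> k\<close> \<open>1 \<le> j\<close>
proof (induction j rule: inc_induct)
  case base
  have "node (i * k + k) x = node ((i + 1) * k) 0" unfolding node_def by (simp add: add.commute)
  with N show ?case by simp
next
  case (step j)
  have ne: "node (i * k + j) x \<noteq> dest"
  proof -
    have "node (i * k + j) x div X < (g + 1) * k"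
    proof -
      have "i * k + j < (i + 1) * k" using step by simp
      also have "\<dots> \<le> (g + 1) * k" using assms by (intro mult_le_mono1) simp
      finally show ?thesis using assms by (simp add: node_div)
    qed
    moreover have "dest div X = (g + 1) * k" using node_div[of 0 "(g + 1) * k"] X_pos dest_eq by simp
    ultimately show ?thesis by auto
  qed
  have csj: "cs ! j \<in> set cs" "cs ! j div n = j" using cs step unfolding transversals_def by auto
  have ins: "{j..<k} = insert j {Suc j..<k}" using step by auto
  let ?V = "(\<lambda>x. mid i x (cs ! j)) ` {x'. valid i x' (cs ! j) \<and> (j = 0 \<or> x' = x)}"
  let ?N = "if \<forall>j'\<in>{Suc j..<k}. valid i x (cs ! j') then N else 0"
  have V: "?V = (if valid i x (cs ! j) then {mid i x (cs ! j)} else {})" using step by auto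
  have "path_count (restricted_edges cs) v dest ?N" if "v \<in> ?V" for v
  proof -
    have v: "v = mid i x (cs ! j)" "valid i x (cs ! j)" using that unfolding V by (auto split: if_splits)
    show ?thesis unfolding v(1)
      by (rule path_count_mid[OF v(2) csj(1)]) (use step csj in simp)
  qed
  from path_count_step[OF ne successors_node[OF assms(1) step.hyps(2) assms(2), symmetric] this]
  have "path_count (restricted_edges cs) (node (i * k + j) x) dest (\<Sum>v\<in>?V. ?N)"
    unfolding V by simp
  also have "(\<Sum>v\<in>?V. ?N) = (if \<forall>j'\<in>{j..<k}. valid i x (cs ! j') then N else 0)"
    unfolding V ins by simp
  finally show ?case .
qed

text \<open>The first step chooses the tuple, and each tuple that survives all \<open>k\<close>
  steps contributes \<open>N\<close>.\<close>

lemma path_count_section: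
  assumes "i \<le> g"
    and N: "path_count (restricted_edges cs) (node ((i + 1) * k) 0) dest N"
  shows "path_count (restricted_edges cs) (node (i * k) 0) dest (section_count cs i * N)"
proof -
  have k0: "0 < k" using k_ge_2 by simp
  have "i * k < (g + 1) * k" using k0 assms by (intro mult_strict_right_mono) auto
  hence ne: "node (i * k) 0 \<noteq> dest"
    using node_div[of 0 "(g + 1) * k"] node_div[of 0 "i * k"] X_pos dest_eq by (metis nat_neq_iff)
  have csj: "cs ! 0 \<in> set cs" "cs ! 0 div n = 0" using cs k0 unfolding transversals_def by auto
  let ?A = "{x. valid i x (cs ! 0)}"
  let ?N = "\<lambda>x. if \<forall>j'\<in>{1..<k}. valid i x (cs ! j') then N else 0"
  let ?m = "\<lambda>x. mid i x (cs ! 0)"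
  have finA: "finite ?A" by (rule finite_subset[of _ "{..<X}"]) (use validD in auto)
  have inj: "inj_on ?m ?A" by (rule inj_onI) (use mid_inj validD in blast)
  \<comment> \<open>\<open>path_count_step\<close> wants the counts as a function of the successor,
    so the tuple is recovered from the middle vertex.\<close>
  have mids: "path_count (restricted_edges cs) v dest (?N (the_inv_into ?A ?m v))" if "v \<in> ?m ` ?A" for v
  proof -
    from that obtain x where x: "x \<in> ?A" "v = ?m x" by blast
    hence "the_inv_into ?A ?m v = x" using inj the_inv_into_f_f by metis
    moreover have "x < X" using x validD by blast
    ultimately show ?thesis
      using path_count_mid[of i x "cs ! 0"] path_count_node[OF assms(1) _ N, of x 1] csj x k_ge_2 by simp
  qed
  have succ: "?m ` ?A = {v. (node (i * k) 0, v) \<in> restricted_edges cs}"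
    using successors_node[OF assms(1) k0 X_pos] by simp
  have "path_count (restricted_edges cs) (node (i * k) 0) dest
      (\<Sum>v\<in>?m ` ?A. ?N (the_inv_into ?A ?m v))"
    by (rule path_count_step[OF ne succ mids finite_imageI[OF finA]])
  also have "(\<Sum>v\<in>?m ` ?A. ?N (the_inv_into ?A ?m v)) = (\<Sum>x\<in>?A. ?N x)"
    unfolding sum.reindex[OF inj] o_def
    by (intro sum.cong refl) (simp only: the_inv_into_f_f[OF inj])
  also have "\<dots> = (\<Sum>x\<in>{x\<in>?A. \<forall>j'\<in>{1..<k}. valid i x (cs ! j')}. N)"
    by (rule sum.inter_filter[OF finA, symmetric])
  also have "{x\<in>?A. \<forall>j'\<in>{1..<k}. valid i x (cs ! j')} = {x. \<forall>j<k. valid i x (cs ! j)}"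
  proof -
    have "(valid i x (cs ! 0) \<and> (\<forall>j'\<in>{1..<k}. valid i x (cs ! j'))) \<longleftrightarrow> (\<forall>j<k. valid i x (cs ! j))" for x
    proof
      assume v: "valid i x (cs ! 0) \<and> (\<forall>j'\<in>{1..<k}. valid i x (cs ! j'))"
      show "\<forall>j<k. valid i x (cs ! j)"
      proof (intro allI impI)
        fix j assume "j < k" thus "valid i x (cs ! j)" using v by (cases j) auto
      qed
    qed (use k0 in simp)
    thus ?thesis by simp
  qed
  finally show ?thesis unfolding section_count_def by simp
qed

lemma path_count_restricted:
  "path_count (restricted_edges cs) 0 dest (\<Prod>i<g + 1. section_count cs i)"
proof -
  have "path_count (restricted_edges cs) (node (i * k) 0) dest (\<Prod>i'\<in>{i..<g + 1}. section_count cs i')"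
    if "i \<le> g + 1" for i
    using that
  proof (induction i rule: inc_induct)
    case base
    show ?case using path_count_target[OF successors_dest] dest_eq by simp
  next
    case (step i)
    have "{i..<g + 1} = insert i {Suc i..<g + 1}" using step by auto
    thus ?case using path_count_section[of i] step by simp
  qed
  from this[of 0] show ?thesis by (simp add: source_eq lessThan_atLeast0)
qed

end

text \<open>The potential of the vertex at position \<open>l\<close> is \<open>l\<close>. This fixes
  the length of the path and locates its edges in the extra section, which has a step for every
  block.\<close>

lemma path_uses_block:
  assumes "is_st_path (edges graph) 0 dest p" "j < k"
  shows "\<exists>e\<in>path_edges p. edge_color e div n = j"
proof -
  have p: "p \<noteq> []" "hd p = 0" "last p = dest"
    and e: "\<And>l. Suc l < length p \<Longrightarrow> (p ! l, p ! Suc l) \<in> edges graph"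
    using assms unfolding is_st_path_def successively_conv_nth by auto
  have pot: "potential (p ! l) = l" if "l < length p" for l
    using that
  proof (induction l)
    case 0
    have "potential (node 0 0) = 0"
      using X_pos node_less(1)[of 0 0 0] k_ge_2 potential_node[of 0 0] by simp
    thus ?case using p by (simp add: hd_conv_nth source_eq)
  next
    case (Suc l)
    thus ?case using potential_edge[OF e] by simp
  qed
  have "potential dest = 2 * ((g + 1) * k)"
    using potential_node[of 0 "(g + 1) * k"] X_pos dest_le dest_eq by simp
  hence len: "length p = Suc (2 * ((g + 1) * k))"
    using pot[of "length p - 1"] p last_conv_nth[OF p(1)] length_greater_0_conv[of p] by simp
  \<comment> \<open>The position where step \<open>j\<close> of section \<open>g\<close> starts. It
    is even, so a node stands there.\<close>
  define l where "l = 2 * (g * k + j)"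
  have l: "Suc l < length p" unfolding l_def len using assms(2) by simp
  have "(p ! l, p ! Suc l) \<in> path_edges p"
    unfolding path_edges_conv_nth using l by blast
  moreover have "edge_color (p ! l, p ! Suc l) div n = j"
    using e[OF l]
  proof (cases rule: edges_cases)
    case (out i x c)
    note v = validD[OF out(1)]
    have "l = 2 * (i * k + c div n)"
      using pot[of l] l potential_node[of x "i * k + c div n"] node_less[of i x "c div n"] v out by simp
    hence "i * k + c div n = g * k + j" unfolding l_def by simp
    from arg_cong[OF this, of "\<lambda>u. u mod k"] have "c div n = j" using v assms(2) by simp
    moreover have "edge_color (p ! l, p ! Suc l) = c"
      by (rule edge_color_pair[OF out(1)]) (simp add: out edge_pair_def)
    ultimately show ?thesis by simp
  next
    case (ret i x c)
    have "l = 2 * (i * k + c div n) + 1"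
      using pot[of l] l potential_mid[of x c i] validD[OF ret(1)] ret by simp
    \<comment> \<open>A middle vertex has odd potential.\<close>
    from arg_cong[OF this, of even] have False unfolding l_def by simp
    thus ?thesis ..
  qed
  ultimately show ?thesis by blast
qed

lemma is_st_path_restricted:
  "is_st_path (restricted_edges cs) s t p \<longleftrightarrow>
     is_st_path (edges graph) s t p \<and> edge_color ` path_edges p \<subseteq> set cs"
  unfolding is_st_path_def successively_conv_nth path_edges_conv_nth restricted_edges_def by auto

text \<open>A path needs a color from each of the \<open>k\<close> disjoint blocks, so a set of only
  \<open>k\<close> colors contains exactly one of each.\<close>

lemma elst_paths_graph:
  "elst_paths k graph = (\<Union>cs\<in>transversals. {p. is_st_path (restricted_edges cs) 0 dest p})"
proof (intro set_eqI iffI)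
  fix p assume "p \<in> elst_paths k graph"
  then obtain K where p: "is_st_path (edges graph) 0 dest p" and
    K: "K \<subseteq> {..<k * n}" "card K = k" "edge_color ` path_edges p \<subseteq> K"
    unfolding elst_paths_def k_colored_st_paths_def colors_def by (auto simp: graph_def)
  have "\<exists>c\<in>K. c div n = j" if "j < k" for j using path_uses_block[OF p that] K(3) by blast
  then obtain f where f: "\<And>j. j < k \<Longrightarrow> f j \<in> K \<and> f j div n = j" by metis
  let ?cs = "map f [0..<k]"
  have tr: "?cs \<in> transversals" unfolding transversals_def using f K(1) by auto
  have "inj_on f {..<k}" by (rule inj_onI) (use f in \<open>metis lessThan_iff\<close>)
  hence "card (set ?cs) = k" by (simp add: card_image atLeast0LessThan)
  moreover have "set ?cs \<subseteq> K" using f by auto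
  moreover have "finite K" using K(1) finite_subset by blast
  ultimately have "set ?cs = K" using K(2) card_subset_eq by blast
  thus "p \<in> (\<Union>cs\<in>transversals. {p. is_st_path (restricted_edges cs) 0 dest p})"
    using tr p K(3) is_st_path_restricted by blast
next
  fix p assume "p \<in> (\<Union>cs\<in>transversals. {p. is_st_path (restricted_edges cs) 0 dest p})"
  then obtain cs where cs: "cs \<in> transversals" and p: "is_st_path (edges graph) 0 dest p"
    "edge_color ` path_edges p \<subseteq> set cs" using is_st_path_restricted by blast
  have nth: "length cs = k" "\<And>j. j < k \<Longrightarrow> cs ! j div n = j"
    using cs unfolding transversals_def by auto
  have "distinct cs" unfolding distinct_conv_nth nth(1)
  proof (intro allI impI)
    fix i j assume "i < k" "j < k" "i \<noteq> j"
    thus "cs ! i \<noteq> cs ! j" using nth(2)[of i] nth(2)[of j] by auto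
  qed
  hence "card (set cs) = k" using cs distinct_card unfolding transversals_def by auto
  moreover have "set cs \<subseteq> {..<k * n}" using transversal_mem[OF cs] by auto
  ultimately show "p \<in> elst_paths k graph"
    using p unfolding elst_paths_def k_colored_st_paths_def colors_def by (auto simp: graph_def)
qed

lemma finite_transversals: "finite transversals"
  by (rule finite_subset[of _ "{cs. set cs \<subseteq> {..<k * n} \<and> length cs = k}"])
    (auto simp: transversals_def in_set_conv_nth finite_lists_length_eq)

text \<open>The union over transversals is disjoint: a path uses an edge of every block, and its
  color determines the entry of the transversal there.\<close>

lemma card_elst_paths:
  "finite (elst_paths k graph)"
  "card (elst_paths k graph) = (\<Sum>cs\<in>transversals. \<Prod>i<g + 1. section_count cs i)"
proof -
  let ?P = "\<lambda>cs. {p. is_st_path (restricted_edges cs) 0 dest p}"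
  note pc = path_count_restricted[unfolded path_count_def]
  show "finite (elst_paths k graph)"
    unfolding elst_paths_graph using pc finite_transversals by blast
  have "?P cs \<inter> ?P cs' = {}" if t: "cs \<in> transversals" "cs' \<in> transversals" "cs \<noteq> cs'" for cs cs'
  proof (rule ccontr)
    assume "?P cs \<inter> ?P cs' \<noteq> {}"
    then obtain p where p: "is_st_path (edges graph) 0 dest p" "edge_color ` path_edges p \<subseteq> set cs"
      "edge_color ` path_edges p \<subseteq> set cs'" using is_st_path_restricted by blast
    have "cs ! j = cs' ! j" if "j < k" for j
    proof -
      obtain e where e: "e \<in> path_edges p" "edge_color e div n = j"
        using path_uses_block[OF p(1) \<open>j < k\<close>] by blast
      hence "edge_color e \<in> set cs" "edge_color e \<in> set cs'" using p(2,3) by blast+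
      thus ?thesis using transversal_mem(3)[OF t(1)] transversal_mem(3)[OF t(2)] e(2) by metis
    qed
    hence "cs = cs'" using t unfolding transversals_def by (auto intro: nth_equalityI)
    thus False using t by simp
  qed
  hence "card (elst_paths k graph) = (\<Sum>cs\<in>transversals. card (?P cs))"
    unfolding elst_paths_graph using pc finite_transversals by (intro card_UN_disjoint) auto
  thus "card (elst_paths k graph) = (\<Sum>cs\<in>transversals. \<Prod>i<g + 1. section_count cs i)"
    using pc by simp
qed

end

section \<open>From factored problems to graphs\<close>

lemma in_listset_iff:
  "vs \<in> listset As \<longleftrightarrow> length vs = length As \<and> (\<forall>j<length As. vs ! j \<in> As ! j)"
proof (induction As arbitrary: vs)
  case (Cons A As)
  show ?case
  proof (cases vs)
    case (Cons v vs')
    thus ?thesis using Cons.IH by (auto simp: set_Cons_def less_Suc_eq_0_disj)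
  qed (simp add: set_Cons_def)
qed simp

lemma finite_listset: "(\<And>A. A \<in> set As \<Longrightarrow> finite A) \<Longrightarrow> finite (listset As)"
proof (induction As)
  case (Cons A As)
  have "set_Cons A (listset As) = (\<lambda>(x, xs). x # xs) ` (A \<times> listset As)"
    by (auto simp: set_Cons_def)
  thus ?case using Cons by simp
qed simp

lemma length_concat_uniform:
  "(\<And>V. V \<in> set Xs \<Longrightarrow> length V = n) \<Longrightarrow> length (concat Xs) = length Xs * n"
  by (induction Xs) auto

lemma nth_concat_uniform:
  assumes "\<And>V. V \<in> set Xs \<Longrightarrow> length V = n" "c < length Xs * n"
  shows "concat Xs ! c = Xs ! (c div n) ! (c mod n)"
  using assms
proof (induction Xs arbitrary: c)
  case (Cons V Xs)
  have n: "n > 0" using Cons.prems(2) by (cases n) auto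
  show ?case
  proof (cases "c < n")
    case False
    hence "c div n = Suc ((c - n) div n)" "c mod n = (c - n) mod n"
      using n by (auto simp: div_if le_mod_geq)
    thus ?thesis using False Cons by (auto simp: nth_append)
  qed (use Cons.prems in \<open>simp add: nth_append\<close>)
qed simp

lemma horner_sum_of_bool_inj:
  assumes "length bs = length cs"
    "horner_sum of_bool (2 :: nat) bs = horner_sum of_bool 2 cs"
  shows "bs = cs"
proof (rule nth_equalityI[OF assms(1)])
  fix i assume "i < length bs"
  thus "bs ! i = cs ! i"
    using arg_cong[OF assms(2), of "\<lambda>x. bit x i"] assms(1) by (simp add: bit_horner_sum_bit_iff)
qed

text \<open>The decoding of an index inside \<open>truth_table\<close>, named in order to show that
  it is bijective.\<close>

definition argument_tuple :: "nat \<Rightarrow> nat \<Rightarrow> nat \<Rightarrow> bool list list" where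
  "argument_tuple k b x = map (\<lambda>j. map (\<lambda>i. bit x (j * b + i)) [0..<b]) [0..<k]"

text \<open>Links the bits of a table index with the shift and remainder by which graph and program
  extract a component.\<close>

lemma argument_tuple_block:
  assumes "j < k"
  shows "horner_sum of_bool 2 (argument_tuple k b x ! j) = x div 2 ^ (j * b) mod 2 ^ b"
proof -
  have "argument_tuple k b x ! j = map (bit (drop_bit (j * b) x)) [0..<b]"
    using assms unfolding argument_tuple_def by (simp add: bit_drop_bit_eq)
  thus ?thesis by (simp only: horner_sum_bit_eq_take_bit) (simp add: take_bit_eq_mod drop_bit_eq_div)
qed

text \<open>Binary expansion: the inverse concatenates the words and reads the result as a
  number.\<close>

lemma bij_betw_argument_tuple:
  "bij_betw (argument_tuple k b) {..<2 ^ (k * b)} {ws. length ws = k \<and> (\<forall>w\<in>set ws. length w = b)}"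
proof (rule bij_betwI')
  fix x y :: nat assume xy: "x \<in> {..<2 ^ (k * b)}" "y \<in> {..<2 ^ (k * b)}"
  show "argument_tuple k b x = argument_tuple k b y \<longleftrightarrow> x = y"
  proof
    assume eq: "argument_tuple k b x = argument_tuple k b y"
    have "bit x p = bit y p" if p: "p < k * b" for p
    proof -
      have b: "p mod b < b" using p by (cases b) auto
      have j: "p div b < k" using p by (metis less_mult_imp_div_less)
      have "argument_tuple k b x ! (p div b) ! (p mod b) = bit x p" for x
        using b j unfolding argument_tuple_def by simp
      thus ?thesis using eq by metis
    qed
    hence "take_bit (k * b) x = take_bit (k * b) y" by (auto simp: bit_eq_iff bit_take_bit_iff)
    thus "x = y" using xy by (simp add: take_bit_eq_mod)
  qed simp
next
  fix x :: nat
  show "argument_tuple k b x \<in> {ws. length ws = k \<and> (\<forall>w\<in>set ws. length w = b)}"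
    unfolding argument_tuple_def by auto
next
  fix ws :: "bool list list" assume "ws \<in> {ws. length ws = k \<and> (\<forall>w\<in>set ws. length w = b)}"
  hence ws: "length ws = k" "\<And>w. w \<in> set ws \<Longrightarrow> length w = b" by auto
  have len: "length (concat ws) = k * b" using length_concat_uniform[of ws b] ws by simp
  define x :: nat where "x = horner_sum of_bool 2 (concat ws)"
  have "x < 2 ^ (k * b)" unfolding x_def using horner_sum_of_bool_2_less[of "concat ws", where ?'a = nat] len by metis
  moreover have "argument_tuple k b x = ws"
  proof (rule nth_equalityI)
    show "length (argument_tuple k b x) = length ws" using ws unfolding argument_tuple_def by simp
  next
    fix j assume "j < length (argument_tuple k b x)"
    hence j: "j < k" unfolding argument_tuple_def by simp
    show "argument_tuple k b x ! j = ws ! j"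
    proof (rule nth_equalityI)
      show "length (argument_tuple k b x ! j) = length (ws ! j)"
        using ws j unfolding argument_tuple_def by simp
    next
      fix i assume "i < length (argument_tuple k b x ! j)"
      hence i: "i < b" using j unfolding argument_tuple_def by simp
      have "j * b + i < (j + 1) * b" using i by simp
      also have "\<dots> \<le> k * b" using j by (intro mult_le_mono1) simp
      finally have ji: "j * b + i < k * b" .
      have "bit x (j * b + i) = concat ws ! (j * b + i)"
        unfolding x_def using ji len by (simp add: bit_horner_sum_bit_iff)
      also have "\<dots> = ws ! j ! i"
        using nth_concat_uniform[of ws b "j * b + i"] ji ws i by simp
      finally show "argument_tuple k b x ! j ! i = ws ! j ! i"
        using i j unfolding argument_tuple_def by simp
    qed
  qed
  ultimately show "\<exists>x\<in>{..<2 ^ (k * b)}. ws = argument_tuple k b x" by auto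
qed

lemma nth_truth_table:
  "x < 2 ^ (k * b) \<Longrightarrow> truth_table k b f ! x = of_bool (f (argument_tuple k b x))"
  unfolding truth_table_def argument_tuple_def by simp

section \<open>The path count as the value of the factored problem\<close>

locale factored_instance =
  fixes k n g b :: nat and f :: "bool list list \<Rightarrow> bool" and Xs :: "bool list list list list list"
  assumes k2: "k \<ge> 2"
    and length_Xs: "length Xs = k"
    and vectors: "V \<in> set Xs \<Longrightarrow> length V = n \<and> distinct (map (map set) V)"
    and vector: "V \<in> set Xs \<Longrightarrow> v \<in> set V \<Longrightarrow>
      length v = g \<and> (\<forall>S\<in>set v. distinct S \<and> (\<forall>w\<in>set S. length w = b))"
begin

abbreviation num :: "bool list \<Rightarrow> nat" where "num \<equiv> horner_sum of_bool 2"

sublocale reduction k n g b "truth_table k b f" "map (map (map num)) (concat Xs)"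
proof
  show "length (map (map (map num)) (concat Xs)) = k * n"
    using length_concat_uniform[of Xs n] vectors length_Xs by simp
  fix v' assume "v' \<in> set (map (map (map num)) (concat Xs))"
  then obtain V v where v: "V \<in> set Xs" "v \<in> set V" "v' = map (map num) v" by auto
  show "length v' = g" using v vector by auto
  fix S' assume "S' \<in> set v'"
  then obtain S where S: "S \<in> set v" "S' = map num S" using v by auto
  have S': "distinct S" "\<And>w. w \<in> set S \<Longrightarrow> length w = b" using vector[OF v(1,2)] S(1) by auto
  have "inj_on num (set S)" by (rule inj_onI) (use S'(2) horner_sum_of_bool_inj in auto)
  moreover have "num w < 2 ^ b" if "w \<in> set S" for w
    using horner_sum_of_bool_2_less[of w, where ?'a = nat] S'(2)[OF that] by simp
  ultimately show "distinct S' \<and> set S' \<subseteq> {..<2 ^ b}"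
    using S S' by (auto simp: distinct_map)
qed (use k2 in \<open>simp_all add: truth_table_def\<close>)

lemma inp_eq: "inp = [n, g, b] @ truth_table k b f @ concat (map set_encode (concat (concat Xs)))"
  unfolding inp_def stream_def set_encode_def
  by (simp add: map_concat[symmetric] o_def flip: map_concat)

definition vector_of :: "nat \<Rightarrow> factored_vector" where
  "vector_of c = map set (concat Xs ! c)"

definition sets :: "factored_vector set list" where
  "sets = map (\<lambda>V. set (map (map set) V)) Xs"

lemma nth_Xs: "c < k * n \<Longrightarrow> concat Xs ! c = Xs ! (c div n) ! (c mod n)"
  using nth_concat_uniform[of Xs n c] vectors length_Xs by simp

lemma nth_Xs_mem:
  assumes "c < k * n"
  shows "Xs ! (c div n) \<in> set Xs" "concat Xs ! c \<in> set (Xs ! (c div n))"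
proof -
  have n: "n > 0" using assms by (cases n) auto
  show 1: "Xs ! (c div n) \<in> set Xs" using color_div_less[OF assms] length_Xs by simp
  show "concat Xs ! c \<in> set (Xs ! (c div n))"
    unfolding nth_Xs[OF assms] using vectors[OF 1] n by simp
qed

text \<open>The same vector may occur in several \<open>V\<^sub>j\<close>, so
  \<open>vector_of\<close> need not be injective on colors. Within a block the vectors are distinct
  as tuples of sets, and the entry at \<open>j\<close> is known to lie in block
  \<open>j\<close>.\<close>

lemma bij_betw_transversals: "bij_betw (map vector_of) transversals (listset sets)"
proof (rule bij_betwI')
  fix cs ds assume t: "cs \<in> transversals" "ds \<in> transversals"
  show "map vector_of cs = map vector_of ds \<longleftrightarrow> cs = ds"
  proof
    assume eq: "map vector_of cs = map vector_of ds"
    have len: "length cs = k" "length ds = k" using t unfolding transversals_def by auto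
    show "cs = ds"
    proof (rule nth_equalityI)
      fix j assume "j < length cs"
      hence j: "j < k" using len by simp
      have c: "cs ! j < k * n" "cs ! j div n = j" "ds ! j < k * n" "ds ! j div n = j"
        using t j unfolding transversals_def by auto
      have n: "n > 0" using c(1) by (cases n) auto
      have V: "Xs ! j \<in> set Xs" using j length_Xs by simp
      have "vector_of (cs ! j) = vector_of (ds ! j)" using arg_cong[OF eq, of "\<lambda>l. l ! j"] j len by simp
      hence "map (map set) (Xs ! j) ! (cs ! j mod n) = map (map set) (Xs ! j) ! (ds ! j mod n)"
        unfolding vector_of_def nth_Xs[OF c(1)] nth_Xs[OF c(3)] using c V vectors n by simp
      hence "cs ! j mod n = ds ! j mod n"
        using vectors[OF V] n nth_eq_iff_index_eq by (metis length_map mod_less_divisor)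
      thus "cs ! j = ds ! j" using c by (metis div_mult_mod_eq)
    qed (simp add: len)
  qed simp
next
  fix cs assume t: "cs \<in> transversals"
  have "vector_of (cs ! j) \<in> sets ! j" if "j < k" for j
  proof -
    have c: "cs ! j < k * n" "cs ! j div n = j" using t that unfolding transversals_def by auto
    show ?thesis using nth_Xs_mem[OF c(1)] that length_Xs unfolding vector_of_def sets_def c(2) by simp
  qed
  thus "map vector_of cs \<in> listset sets"
    using t length_Xs unfolding in_listset_iff transversals_def by (simp add: sets_def)
next
  fix vs assume "vs \<in> listset sets"
  hence vs: "length vs = k" "\<And>j. j < k \<Longrightarrow> vs ! j \<in> sets ! j"
    unfolding in_listset_iff by (simp_all add: sets_def length_Xs)
  have "\<exists>c. c < k * n \<and> c div n = j \<and> vector_of c = vs ! j" if j: "j < k" for j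
  proof -
    have V: "Xs ! j \<in> set Xs" using j length_Xs by simp
    from vs(2)[OF j] obtain u where u: "u < n" "vs ! j = map set (Xs ! j ! u)"
      using j length_Xs vectors[OF V] unfolding sets_def by (auto simp: in_set_conv_nth)
    have "j * n + u < (j + 1) * n" using u by simp
    also have "\<dots> \<le> k * n" using j by (intro mult_le_mono1) simp
    finally have c: "j * n + u < k * n" .
    thus ?thesis using u nth_Xs[OF c] unfolding vector_of_def by (intro exI[of _ "j * n + u"]) simp
  qed
  then obtain h where h: "\<And>j. j < k \<Longrightarrow> h j < k * n \<and> h j div n = j \<and> vector_of (h j) = vs ! j" by metis
  show "\<exists>cs\<in>transversals. vs = map vector_of cs"
  proof (rule bexI[of _ "map h [0..<k]"])
    show "vs = map vector_of (map h [0..<k])" by (rule nth_equalityI) (use vs h in simp_all)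
    show "map h [0..<k] \<in> transversals" unfolding transversals_def using h by simp
  qed
qed

text \<open>\<open>argument_tuple\<close> carries the tuples valid for all \<open>k\<close> colors
  to the argument lists in the product of the components on which \<open>f\<close> holds.\<close>

lemma section_count_eq:
  assumes t: "cs \<in> transversals" and i: "i < g"
  shows "section_count cs i =
    (\<Sum>ws\<in>listset (map (\<lambda>v. v ! i) (map vector_of cs)). of_bool (f ws))"
proof -
  let ?A = "listset (map (\<lambda>v. v ! i) (map vector_of cs))"
  have len: "length cs = k" and c: "\<And>j. j < k \<Longrightarrow> cs ! j < k * n \<and> cs ! j div n = j"
    using t unfolding transversals_def by auto
  have S: "vector_of (cs ! j) ! i = set (concat Xs ! (cs ! j) ! i)"
    "\<And>w. w \<in> vector_of (cs ! j) ! i \<Longrightarrow> length w = b"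
    "set (map (map (map num)) (concat Xs) ! (cs ! j) ! i) = num ` (vector_of (cs ! j) ! i)"
    if j: "j < k" for j
  proof -
    let ?v = "concat Xs ! (cs ! j)"
    have v: "Xs ! (cs ! j div n) \<in> set Xs" "?v \<in> set (Xs ! (cs ! j div n))" using nth_Xs_mem c[OF j] by blast+
    note v' = vector[OF v]
    show 1: "vector_of (cs ! j) ! i = set (?v ! i)" using v' i unfolding vector_of_def by simp
    show "length w = b" if "w \<in> vector_of (cs ! j) ! i" for w
      using v' i that unfolding 1 by (metis nth_mem)
    show "set (map (map (map num)) (concat Xs) ! (cs ! j) ! i) = num ` (vector_of (cs ! j) ! i)"
      unfolding 1 using c[OF j] length_W v' i by (simp del: length_concat)
  qed
  have A: "ws \<in> ?A \<longleftrightarrow> length ws = k \<and> (\<forall>j<k. ws ! j \<in> vector_of (cs ! j) ! i)" for ws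
    unfolding in_listset_iff using len by simp
  have valid_iff: "(\<forall>j<k. valid i x (cs ! j)) \<longleftrightarrow>
      x < 2 ^ (k * b) \<and> argument_tuple k b x \<in> ?A \<and> f (argument_tuple k b x)" for x
  proof (cases "x < 2 ^ (k * b)")
    case True
    have at: "length (argument_tuple k b x) = k" "\<And>j. j < k \<Longrightarrow> length (argument_tuple k b x ! j) = b"
      unfolding argument_tuple_def by simp_all
    have "valid i x (cs ! j) \<longleftrightarrow> f (argument_tuple k b x) \<and> argument_tuple k b x ! j \<in> vector_of (cs ! j) ! i"
      if j: "j < k" for j
    proof -
      \<comment> \<open>Words padded with zeros have equal \<open>num\<close>, so membership passes
        from numbers to words only because all words have length \<open>b\<close>.\<close>
      have "num (argument_tuple k b x ! j) \<in> num ` (vector_of (cs ! j) ! i) \<longleftrightarrow>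
          argument_tuple k b x ! j \<in> vector_of (cs ! j) ! i"
        using horner_sum_of_bool_inj S(2)[OF j] at(2)[OF j] by (metis (no_types, lifting) imageE image_eqI)
      thus ?thesis unfolding valid_def S(3)[OF j]
        using c[OF j] i True argument_tuple_block[OF j, of b x] nth_truth_table[OF True, of f] by (simp add: X_def)
    qed
    \<comment> \<open>With an empty range of \<open>j\<close> the condition on \<open>f\<close>
      would vanish from the quantified statement.\<close>
    moreover have "0 < k" using k2 by simp
    ultimately show ?thesis using True at(1) unfolding A by blast
  next
    case False
    hence "\<not> valid i x (cs ! 0)" using validD[of i x "cs ! 0"] unfolding X_def by auto
    moreover have "0 < k" using k2 by simp
    ultimately show ?thesis using False by blast
  qed
  have sub: "?A \<subseteq> {ws. length ws = k \<and> (\<forall>w\<in>set ws. length w = b)}"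
  proof
    fix ws assume "ws \<in> ?A"
    hence "length ws = k" "\<And>j. j < k \<Longrightarrow> length (ws ! j) = b" unfolding A using S(2) by auto
    thus "ws \<in> {ws. length ws = k \<and> (\<forall>w\<in>set ws. length w = b)}" by (auto simp: in_set_conv_nth)
  qed
  note bij = bij_betw_argument_tuple[of k b]
  have "inj_on (argument_tuple k b) {x. \<forall>j<k. valid i x (cs ! j)}"
    by (rule inj_on_subset[OF bij_betw_imp_inj_on[OF bij]]) (use valid_iff in auto)
  hence "section_count cs i = card (argument_tuple k b ` {x. \<forall>j<k. valid i x (cs ! j)})"
    unfolding section_count_def by (simp add: card_image)
  also have "argument_tuple k b ` {x. \<forall>j<k. valid i x (cs ! j)} = {ws \<in> ?A. f ws}"
  proof (intro set_eqI iffI)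
    fix ws assume ws: "ws \<in> {ws \<in> ?A. f ws}"
    hence "ws \<in> argument_tuple k b ` {..<2 ^ (k * b)}" using sub bij_betw_imp_surj_on[OF bij] by blast
    thus "ws \<in> argument_tuple k b ` {x. \<forall>j<k. valid i x (cs ! j)}" using ws valid_iff by auto
  qed (use valid_iff in auto)
  also have "card {ws \<in> ?A. f ws} = (\<Sum>ws\<in>?A. of_bool (f ws))"
  proof -
    have "finite ?A"
    proof (rule finite_listset)
      fix A assume "A \<in> set (map (\<lambda>v. v ! i) (map vector_of cs))"
      then obtain j where "j < k" "A = vector_of (cs ! j) ! i" using len by (auto simp: in_set_conv_nth)
      thus "finite A" using S(1) by simp
    qed
    thus ?thesis by (simp add: Int_def)
  qed
  finally show ?thesis .
qed

text \<open>The extra section forces every block to be used without changing the count.\<close>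

lemma section_count_last: "cs \<in> transversals \<Longrightarrow> section_count cs g = 1"
proof -
  assume "cs \<in> transversals"
  hence "{x. \<forall>j<k. valid g x (cs ! j)} = {0}"
    using k2 unfolding transversals_def valid_def by (auto intro: exI[of _ 0])
  thus ?thesis unfolding section_count_def by simp
qed

lemma card_elst_paths_eq: "card (elst_paths k graph) = factored_count g f sets"
proof -
  have "card (elst_paths k graph) = (\<Sum>cs\<in>transversals. \<Prod>i<g.
      \<Sum>ws\<in>listset (map (\<lambda>v. v ! i) (map vector_of cs)). of_bool (f ws))"
    unfolding card_elst_paths(2)
    by (intro sum.cong refl) (simp add: section_count_last section_count_eq)
  also have "\<dots> = factored_count g f sets"
    unfolding factored_count_def by (rule sum.reindex_bij_betw[OF bij_betw_transversals])
  finally show ?thesis .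
qed

end

section \<open>Size and running time of the reduction\<close>

text \<open>The factors are \<open>X = 2 ^ (k * b)\<close> tuples, \<open>2 ^ b\<close> words tried
  with each tuple, and \<open>2 ^ g\<close> for the isolated vertices, which also bounds the
  \<open>g + 1\<close> sections.\<close>

definition overhead :: "nat \<Rightarrow> nat \<Rightarrow> nat \<Rightarrow> nat" where
  "overhead k g b = 2 ^ ((k + 1) * b + g)"

text \<open>One generous bound for the graph, the numbers of the program and its running
  time.\<close>

definition size_bound :: "nat \<Rightarrow> nat \<Rightarrow> nat \<Rightarrow> nat \<Rightarrow> nat" where
  "size_bound k n g b = 1000 * k * (n + 1) * overhead k g b"

context reduction
begin

abbreviation Z :: nat where "Z \<equiv> overhead k g b"

lemma Z_eq: "Z = 2 ^ g * (X * 2 ^ b)"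
  unfolding overhead_def X_def by (simp add: power_add algebra_simps)

lemma suc_g_le: "g + 1 \<le> 2 ^ g"
  by (simp add: Suc_le_eq)

lemma Z_bounds: "(g + 1) * (X * 2 ^ b) \<le> Z" "(g + 1) * X \<le> Z" "2 ^ g \<le> Z" "X \<le> Z" "1 \<le> Z"
  "(g + 1) * 2 ^ b \<le> Z"
proof -
  have X1: "X \<ge> 1" using X_pos by simp
  show 1: "(g + 1) * (X * 2 ^ b) \<le> Z" unfolding Z_eq by (rule mult_le_mono1[OF suc_g_le])
  have "(g + 1) * (X * 1) \<le> (g + 1) * (X * 2 ^ b)" by (intro mult_le_mono le_refl) simp
  thus 2: "(g + 1) * X \<le> Z" using 1 by simp
  have "(g + 1) * (1 * 2 ^ b) \<le> (g + 1) * (X * 2 ^ b)" by (intro mult_le_mono le_refl X1)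
  thus "(g + 1) * 2 ^ b \<le> Z" using 1 by simp
  have "2 ^ g * (1 * 1) \<le> Z" unfolding Z_eq by (intro mult_le_mono le_refl X1) simp
  thus "2 ^ g \<le> Z" by simp
  show "X \<le> Z" using 2 by simp
  thus "1 \<le> Z" using X1 by simp
qed

lemma vertex_number_le: "vertex_number \<le> (2 * k + 1) * (n + 1) * Z"
proof -
  have "g * k + k + 1 \<le> 2 * k * (g + 1)" using k_ge_2 by (simp add: algebra_simps)
  hence "mid_base \<le> 2 * k * (g + 1) * X" unfolding mid_base_def by (rule mult_le_mono1)
  also have "\<dots> = 2 * k * ((g + 1) * X)" by (simp only: mult.assoc)
  also have "\<dots> \<le> 2 * k * Z" by (rule mult_le_mono2[OF Z_bounds(2)])
  finally have 1: "mid_base \<le> 2 * k * Z" .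
  have 2: "(g + 1) * X * (k * n) \<le> Z * (k * n)" by (rule mult_le_mono1[OF Z_bounds(2)])
  have "vertex_number \<le> 2 * k * Z + Z * (k * n) + Z"
    unfolding vertex_number_def using 1 2 Z_bounds(3) by linarith
  also have "\<dots> \<le> (2 * k + 1) * (n + 1) * Z" by (simp add: algebra_simps)
  finally show ?thesis .
qed

lemma length_words_le:
  assumes "v \<in> set W" "S \<in> set v"
  shows "length S \<le> 2 ^ b"
proof -
  note S = words[OF assms]
  have "length S = card (set S)" using S by (simp add: distinct_card)
  also have "\<dots> \<le> card {..<2 ^ b :: nat}" using S by (intro card_mono) auto
  finally show ?thesis by simp
qed

lemma length_inp_le: "length inp \<le> (4 + 2 * k) * (n + 1) * Z"
proof -
  have "length stream \<le> length (concat W) * (1 + 2 ^ b)"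
    unfolding stream_def by (rule length_concat_map_le) (use length_words_le in fastforce)
  also have "length (concat W) = k * n * g" using length_concat_uniform[of W g] length_vec length_W by simp
  also have "k * n * g * (1 + 2 ^ b) \<le> k * n * ((g + 1) * (2 * 2 ^ b))"
    unfolding mult.assoc by (intro mult_le_mono le_refl) auto
  also have "\<dots> = 2 * k * n * ((g + 1) * 2 ^ b)" by simp
  also have "\<dots> \<le> 2 * k * n * Z" by (rule mult_le_mono2[OF Z_bounds(6)])
  finally have "length inp \<le> 3 + Z + 2 * k * n * Z"
    using length_tt Z_bounds(4) unfolding inp_def X_def by simp
  also have "\<dots> \<le> (4 + 2 * k) * (n + 1) * Z" using Z_bounds(5) by (simp add: algebra_simps)
  finally show ?thesis .
qed

lemma length_all_edges_le: "length all_edges \<le> 2 * k * n * Z"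
proof -
  have "length (color_edges c) \<le> 2 * Z" if c: "c < k * n" for c
  proof -
    have v: "W ! c \<in> set W" using c length_W by simp
    have te: "length (tuple_edges c i w x) \<le> 2" for i w x unfolding tuple_edges_def edge_pair_def by simp
    have we: "length (word_edges c i w) \<le> X * 2" for i w
      unfolding word_edges_def using length_concat_map_le[of "[0..<X]" "tuple_edges c i w" 2] te by simp
    have se: "length (section_edges c (W ! c) i) \<le> 2 ^ b * (X * 2)" if i: "i < g" for i
    proof -
      have "W ! c ! i \<in> set (W ! c)" using length_vec[OF v] i by simp
      hence l: "length (W ! c ! i) \<le> 2 ^ b" using length_words_le[OF v] by simp
      have "length (section_edges c (W ! c) i) \<le> length (W ! c ! i) * (X * 2)"
        unfolding section_edges_def
        using length_concat_map_le[of "[0..<length (W ! c ! i)]" "\<lambda>l. word_edges c i (W ! c ! i ! l)" "X * 2"] we by simp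
      also have "\<dots> \<le> 2 ^ b * (X * 2)" by (rule mult_le_mono1[OF l])
      finally show ?thesis .
    qed
    have "length (concat (map (section_edges c (W ! c)) [0..<g])) \<le> g * (2 ^ b * (X * 2))"
      using length_concat_map_le[of "[0..<g]" "section_edges c (W ! c)" "2 ^ b * (X * 2)"] se by simp
    hence "length (color_edges c) \<le> g * (2 ^ b * (X * 2)) + 2"
      unfolding color_edges_def edge_pair_def by simp
    also have "\<dots> \<le> g * (2 ^ b * (X * 2)) + 2 ^ b * (X * 2)"
      using mult_le_mono[of 1 "2 ^ b" 1 X] X_pos by simp
    also have "\<dots> = 2 * ((g + 1) * (X * 2 ^ b))" by (simp add: algebra_simps)
    also have "\<dots> \<le> 2 * Z" by (rule mult_le_mono2[OF Z_bounds(1)])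
    finally show ?thesis .
  qed
  hence "length all_edges \<le> k * n * (2 * Z)"
    unfolding all_edges_def using length_concat_map_le[of "[0..<k * n]" color_edges "2 * Z"] by simp
  thus ?thesis by simp
qed

text \<open>Every color has a pair in the extra section. A lower bound on the edges is required when
  \<open>1 - \<epsilon>\<close> is negative, as the time bound then decreases in their
  number.\<close>

lemma length_all_edges_ge: "n \<le> length all_edges"
proof -
  have "k * n * 1 \<le> length all_edges"
    unfolding all_edges_def using length_concat_map_ge[of "[0..<k * n]" 1 color_edges]
    by (simp add: color_edges_def edge_pair_def)
  moreover have "1 * n \<le> k * n" using k_ge_2 by (intro mult_le_mono1) simp
  ultimately show ?thesis by linarith
qed

lemma card_edges_graph: "card (edges graph) = length all_edges"
  unfolding edges_def graph_def using distinct_all_edges by (simp add: distinct_card)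

lemma card_colors_graph: "card (colors graph) = k * n"
  unfolding colors_def graph_def by simp

lemma size_bounds:
  defines "D \<equiv> size_bound k n g b"
  shows "vertex_number < D" "2 * length inp + 5 + 3 * length all_edges < D"
    "elst_size graph \<le> D" "card (edges graph) \<le> D"
proof -
  define m where "m = (n + 1) * Z"
  have m: "m \<ge> 1" unfolding m_def using Z_bounds(5) by simp
  have v: "vertex_number \<le> 2 * (k * m) + m" using vertex_number_le unfolding m_def by (simp add: algebra_simps)
  have i: "length inp \<le> 4 * m + 2 * (k * m)" using length_inp_le unfolding m_def by (simp add: algebra_simps)
  have "length all_edges \<le> 2 * (k * (n * Z))" using length_all_edges_le by simp
  also have "\<dots> \<le> 2 * (k * m)" unfolding m_def by simp
  finally have e: "length all_edges \<le> 2 * (k * m)" .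
  have "n * 1 \<le> (n + 1) * Z" using Z_bounds(5) by (intro mult_le_mono) auto
  hence "k * n \<le> k * m" unfolding m_def by simp
  hence sz: "elst_size graph \<le> vertex_number + length all_edges + k * m"
    unfolding elst_size_def card_edges_graph card_colors_graph by (simp add: graph_def)
  have km: "2 * m \<le> k * m" using k_ge_2 by simp
  have D: "D = 1000 * (k * m)" unfolding D_def size_bound_def m_def by (simp only: mult.assoc)
  show "vertex_number < D" "2 * length inp + 5 + 3 * length all_edges < D" "elst_size graph \<le> D"
    "card (edges graph) \<le> D"
    using v i e sz km m unfolding D card_edges_graph by linarith+
qed

end

context bounded_reduction
begin

lemma color_time_le: "color_time + 1 \<le> 200 * Z"
proof -
  let ?q = "X * 2 ^ b"
  have q: "?q \<ge> 1" "2 ^ b \<le> ?q" using X_pos by simp_all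
  have "section_time = 81 * ?q + 11 * 2 ^ b + 10" unfolding section_time_def by (simp add: algebra_simps)
  hence "section_time + 1 \<le> 103 * ?q" using q by linarith
  hence "g * (section_time + 1) \<le> g * (103 * ?q)" by (rule mult_le_mono2)
  hence "color_time + 1 \<le> g * (103 * ?q) + 61" unfolding color_time_def by simp
  also have "\<dots> \<le> g * (200 * ?q) + 200 * ?q"
    using q(1) mult_le_mono2[of "103 * ?q" "200 * ?q" g] by linarith
  also have "\<dots> = 200 * ((g + 1) * ?q)" by (simp add: algebra_simps)
  also have "\<dots> \<le> 200 * Z" by (rule mult_le_mono2[OF Z_bounds(1)])
  finally show ?thesis .
qed

lemma reduction_prog_executes:
  "runs B (reduction_prog k) (init_state inp) (size_bound k n g b) (\<lambda>s. s = init_state (elst_encode graph))"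
proof -
  define m where "m = (n + 1) * Z"
  have m: "m \<ge> 1" unfolding m_def using Z_bounds(5) by simp
  have i: "length inp \<le> 4 * m + 2 * (k * m)" using length_inp_le unfolding m_def by (simp add: algebra_simps)
  have "length all_edges \<le> 2 * (k * (n * Z))" using length_all_edges_le by simp
  also have "\<dots> \<le> 2 * (k * m)" unfolding m_def by simp
  finally have e: "length all_edges \<le> 2 * (k * m)" .
  have km: "2 * m \<le> k * m" using k_ge_2 by simp
  define T where "T = k * n * (color_time + 1)"
  have "T \<le> k * n * (200 * Z)" unfolding T_def by (rule mult_le_mono2[OF color_time_le])
  also have "\<dots> = 200 * (k * (n * Z))" by simp
  also have "\<dots> \<le> 200 * (k * m)" unfolding m_def by simp
  finally have t: "T \<le> 200 * (k * m)" .
  have D: "size_bound k n g b = 1000 * (k * m)" unfolding size_bound_def m_def by (simp only: mult.assoc)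
  have le: "k * n * (color_time + 1) + 7 * (length inp + 5 + 3 * length all_edges) + 120 \<le> size_bound k n g b"
  proof -
    obtain q where q: "q = k * m" by simp
    show ?thesis using t i e km m unfolding D T_def[symmetric] q[symmetric] by simp
  qed
  have "elst_encode graph = header (length all_edges) @ edge_words"
    unfolding elst_encode_def header_def edge_words_def edge_words_eq by (simp add: graph_def)
  with runs_mono[OF reduction_prog_runs le] show ?thesis by simp
qed

end

context reduction
begin

text \<open>At most \<open>V ^ k\<close> transversals have at most \<open>X ^ g\<close> paths each.
  With \<open>L\<close> the binary logarithm of \<open>V\<close>, \<open>X \<le> V\<close> gives
  \<open>k * b \<le> L\<close> and the isolated vertices give \<open>g \<le> L\<close>, so the
  exponent is at most \<open>k * L + L * L\<close>.\<close>

lemma card_elst_paths_less: "card (elst_paths k graph) < ELstC_modulus k (nverts graph)"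
proof -
  define V where "V = vertex_number"
  define L where "L = log 2 (real V)"
  have X1: "X \<ge> 1" using X_pos by simp
  \<comment> \<open>From \<open>k \<ge> 2\<close>; it yields \<open>V \<ge> 3\<close>, hence
    \<open>L > 1\<close>, which makes the final comparison strict.\<close>
  have mb: "mid_base \<ge> 3 * X" unfolding mid_base_def using k_ge_2 by (intro mult_le_mono1) simp
  have V3: "V \<ge> 3" and XV: "X \<le> V" and gV: "2 ^ g \<le> V"
    using mb X1 unfolding V_def vertex_number_def by linarith+
  have "1 * (k * n) \<le> (g + 1) * X * (k * n)" using X1 by (intro mult_le_mono1) simp
  hence knV: "k * n \<le> V" unfolding V_def vertex_number_def by linarith
  have L1: "L > 1"
  proof -
    have "log 2 2 < log 2 (real V)" using V3 by (subst log_less_cancel_iff) auto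
    thus ?thesis unfolding L_def by simp
  qed
  have pL: "2 powr L = real V" unfolding L_def using V3 by simp
  have pow_le: "real a \<le> L" if "2 ^ a \<le> V" for a :: nat
    unfolding L_def using that by (rule le_log2_of_power)
  have sc: "section_count cs i \<le> X" if "cs \<in> transversals" for cs i
  proof -
    have "{x. \<forall>j<k. valid i x (cs ! j)} \<subseteq> {..<X}" using validD k_ge_2 by force
    from card_mono[OF _ this] show ?thesis unfolding section_count_def by simp
  qed
  have last: "section_count cs g \<le> 1" for cs
  proof -
    have "{x. \<forall>j<k. valid g x (cs ! j)} \<subseteq> {0}" using k_ge_2 unfolding valid_def by fastforce
    from card_mono[OF _ this] show ?thesis unfolding section_count_def by simp
  qed
  have "card transversals \<le> card {cs. set cs \<subseteq> {..<k * n} \<and> length cs = k}"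
    by (rule card_mono) (auto simp: transversals_def in_set_conv_nth finite_lists_length_eq)
  also have "\<dots> = (k * n) ^ k" by (subst card_lists_length_eq) auto
  also have "\<dots> \<le> V ^ k" by (rule power_mono[OF knV]) simp
  finally have tr: "card transversals \<le> V ^ k" .
  have "card (elst_paths k graph) \<le> (\<Sum>cs\<in>transversals. X ^ g)"
    unfolding card_elst_paths(2)
  proof (rule sum_mono)
    fix cs assume cs: "cs \<in> transversals"
    have "(\<Prod>i<g. section_count cs i) \<le> (\<Prod>i<g. X)" by (rule prod_mono) (use sc[OF cs] in simp)
    thus "(\<Prod>i<g + 1. section_count cs i) \<le> X ^ g"
      using mult_mono[OF _ last, of "\<Prod>i<g. section_count cs i" "X ^ g" cs] by simp
  qed
  also have "\<dots> \<le> V ^ k * X ^ g" using tr by simp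
  finally have "real (card (elst_paths k graph)) \<le> real (V ^ k * X ^ g)" by (rule of_nat_mono)
  also have "\<dots> = (2 powr L) ^ k * (2 powr real (k * b)) ^ g"
    unfolding X_def using pL powr_realpow[of 2 "k * b"] by simp
  also have "\<dots> = 2 powr (real k * L + real (k * b) * real g)"
    by (simp add: powr_add powr_power mult.commute)
  also have "\<dots> \<le> 2 powr (real k * L + L * L)"
    using pow_le[of "k * b"] pow_le[of g] XV gV L1 unfolding X_def by (intro powr_mono add_mono mult_mono) auto
  also have "\<dots> < 2 powr (2 * real k * L\<^sup>2)"
  proof -
    have "real k * L < real k * (L * L)" using k_ge_2 L1 by simp
    moreover have "1 * (L * L) \<le> real k * (L * L)" using k_ge_2 by (intro mult_right_mono) auto
    ultimately have "real k * L + L * L < 2 * real k * L\<^sup>2" by (simp add: power2_eq_square)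
    thus ?thesis by simp
  qed
  also have "\<dots> \<le> 2 powr real (nat \<lceil>2 * real k * L\<^sup>2\<rceil>)" by (intro powr_mono) linarith+
  also have "\<dots> = real (ELstC_modulus k (nverts graph))"
    unfolding ELstC_modulus_def L_def V_def by (subst powr_realpow) (simp_all add: graph_def)
  finally show ?thesis by simp
qed

end

section \<open>Subpolynomial functions\<close>

text \<open>A bound valid for all \<open>n\<close>, with \<open>n + 1\<close> to avoid 0, spares the
  later estimates any condition that \<open>n\<close> be large.\<close>

lemma subpolynomial_iff:
  "subpolynomial h \<longleftrightarrow> (\<forall>\<delta>>0. \<exists>C. \<forall>n. \<bar>h n\<bar> \<le> C * (real n + 1) powr \<delta>)"
proof
  assume h: "subpolynomial h"
  show "\<forall>\<delta>>0. \<exists>C. \<forall>n. \<bar>h n\<bar> \<le> C * (real n + 1) powr \<delta>"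
  proof (intro allI impI)
    fix \<delta> :: real assume \<delta>: "\<delta> > 0"
    from h \<delta> have "h \<in> O(\<lambda>n. real n powr \<delta>)" unfolding subpolynomial_def by blast
    then obtain c where c: "c > 0" "eventually (\<lambda>n. norm (h n) \<le> c * norm (real n powr \<delta>)) at_top"
      by (elim landau_o.bigE)
    then obtain N where N: "\<And>n. n \<ge> N \<Longrightarrow> \<bar>h n\<bar> \<le> c * real n powr \<delta>"
      unfolding eventually_at_top_linorder by auto
    \<comment> \<open>The sum absorbs the finitely many values before the asymptotic bound sets
      in.\<close>
    define C where "C = c + (\<Sum>n<N. \<bar>h n\<bar>)"
    have "\<bar>h n\<bar> \<le> C * (real n + 1) powr \<delta>" for n
    proof (cases "n < N")
      case True
      have "\<bar>h n\<bar> \<le> (\<Sum>n<N. \<bar>h n\<bar>)" using True by (intro member_le_sum) auto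
      also have "\<dots> \<le> C" unfolding C_def using c by simp
      also have "C * 1 \<le> C * (real n + 1) powr \<delta>"
        using \<delta> c unfolding C_def by (intro mult_left_mono ge_one_powr_ge_zero add_nonneg_nonneg sum_nonneg) auto
      finally show ?thesis by simp
    next
      case False
      hence "\<bar>h n\<bar> \<le> c * real n powr \<delta>" using N by simp
      also have "\<dots> \<le> C * (real n + 1) powr \<delta>"
        using c \<delta> unfolding C_def by (intro mult_mono powr_mono2 add_nonneg_nonneg) (auto intro: sum_nonneg)
      finally show ?thesis .
    qed
    thus "\<exists>C. \<forall>n. \<bar>h n\<bar> \<le> C * (real n + 1) powr \<delta>" by blast
  qed
next
  assume h: "\<forall>\<delta>>0. \<exists>C. \<forall>n. \<bar>h n\<bar> \<le> C * (real n + 1) powr \<delta>"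
  show "subpolynomial h"
    unfolding subpolynomial_def
  proof (intro allI impI)
    fix \<delta> :: real assume \<delta>: "\<delta> > 0"
    then obtain C where C: "\<And>n. \<bar>h n\<bar> \<le> C * (real n + 1) powr \<delta>" using h by blast
    have C0: "C \<ge> 0" using C[of 0] by simp
    show "h \<in> O(\<lambda>n. real n powr \<delta>)"
    proof (rule landau_o.bigI[of "C * 2 powr \<delta> + 1"])
      show "eventually (\<lambda>n. norm (h n) \<le> (C * 2 powr \<delta> + 1) * norm (real n powr \<delta>)) at_top"
        using eventually_ge_at_top[of 1]
      proof eventually_elim
        case (elim n)
        have "\<bar>h n\<bar> \<le> C * (real n + 1) powr \<delta>" by (rule C)
        also have "\<dots> \<le> C * (2 * real n) powr \<delta>"
          using elim C0 \<delta> by (intro mult_left_mono powr_mono2) auto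
        also have "\<dots> = C * 2 powr \<delta> * real n powr \<delta>" by (simp add: powr_mult)
        also have "\<dots> \<le> (C * 2 powr \<delta> + 1) * real n powr \<delta>" by (intro mult_right_mono) auto
        finally show ?case by simp
      qed
    qed (use C0 in \<open>simp add: add_nonneg_pos\<close>)
  qed
qed

lemma subpolynomial_add:
  assumes "subpolynomial h" "subpolynomial h'"
  shows "subpolynomial (\<lambda>n. h n + h' n)"
  using assms unfolding subpolynomial_def by (auto intro: sum_in_bigo)

lemma subpolynomial_const: "subpolynomial (\<lambda>_. c)"
  unfolding subpolynomial_iff
proof (intro allI impI)
  fix \<delta> :: real assume "\<delta> > 0"
  have "\<bar>c\<bar> * 1 \<le> \<bar>c\<bar> * (real n + 1) powr \<delta>" for n
    using \<open>\<delta> > 0\<close> by (intro mult_left_mono ge_one_powr_ge_zero) auto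
  thus "\<exists>C. \<forall>n. \<bar>c\<bar> \<le> C * (real n + 1) powr \<delta>" by auto
qed

lemma subpolynomial_mult:
  assumes "subpolynomial h" "subpolynomial h'"
  shows "subpolynomial (\<lambda>n. h n * h' n)"
  unfolding subpolynomial_iff
proof (intro allI impI)
  fix \<delta> :: real assume "\<delta> > 0"
  then obtain C C' where C: "\<And>n. \<bar>h n\<bar> \<le> C * (real n + 1) powr (\<delta> / 2)"
      "\<And>n. \<bar>h' n\<bar> \<le> C' * (real n + 1) powr (\<delta> / 2)"
    using assms unfolding subpolynomial_iff by (metis half_gt_zero)
  have "\<bar>h n * h' n\<bar> \<le> C * C' * (real n + 1) powr \<delta>" for n
  proof -
    have "C \<ge> 0" using C(1)[of 0] by simp
    have "\<bar>h n * h' n\<bar> \<le> (C * (real n + 1) powr (\<delta> / 2)) * (C' * (real n + 1) powr (\<delta> / 2))"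
      unfolding abs_mult using C \<open>C \<ge> 0\<close> by (intro mult_mono) auto
    also have "\<dots> = C * C' * ((real n + 1) powr (\<delta> / 2) * (real n + 1) powr (\<delta> / 2))" by simp
    also have "(real n + 1) powr (\<delta> / 2) * (real n + 1) powr (\<delta> / 2) = (real n + 1) powr \<delta>"
      by (simp flip: powr_add)
    finally show ?thesis .
  qed
  thus "\<exists>C. \<forall>n. \<bar>h n * h' n\<bar> \<le> C * (real n + 1) powr \<delta>" by blast
qed

text \<open>Makes a time factor monotone, so that it can be evaluated at a bound of the instance size.\<close>

definition running_max :: "(nat \<Rightarrow> real) \<Rightarrow> nat \<Rightarrow> real" where
  "running_max h m = Max ((\<lambda>j. \<bar>h j\<bar>) ` {..m})"

lemma running_max_ge: "j \<le> m \<Longrightarrow> \<bar>h j\<bar> \<le> running_max h m"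
  unfolding running_max_def by (intro Max_ge) auto

text \<open>The graph size is at most quadratic in \<open>n\<close>, so exponent
  \<open>\<delta> / 2\<close> in the size becomes exponent \<open>\<delta>\<close> in
  \<open>n\<close>.\<close>

lemma subpolynomial_running_max_comp:
  assumes h: "subpolynomial h" and D: "\<And>n. real (D n) + 1 \<le> K * (real n + 1)\<^sup>2"
  shows "subpolynomial (\<lambda>n. running_max h (D n))"
  unfolding subpolynomial_iff
proof (intro allI impI)
  fix \<delta> :: real assume \<delta>: "\<delta> > 0"
  then obtain C where C: "\<And>n. \<bar>h n\<bar> \<le> C * (real n + 1) powr (\<delta> / 2)"
    using h unfolding subpolynomial_iff by (metis half_gt_zero)
  have C0: "C \<ge> 0" using C[of 0] by simp
  have K0: "K \<ge> 0" using D[of 0] by simp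
  have "\<bar>running_max h (D n)\<bar> \<le> C * K powr (\<delta> / 2) * (real n + 1) powr \<delta>" for n
  proof -
    have "running_max h (D n) \<in> (\<lambda>j. \<bar>h j\<bar>) ` {..D n}"
      unfolding running_max_def by (rule Max_in) auto
    then obtain j where j: "j \<le> D n" "running_max h (D n) = \<bar>h j\<bar>" by auto
    have "\<bar>running_max h (D n)\<bar> \<le> C * (real j + 1) powr (\<delta> / 2)" using C j by simp
    also have "\<dots> \<le> C * (K * (real n + 1)\<^sup>2) powr (\<delta> / 2)"
      using C0 \<delta> j(1) D[of n] by (intro mult_left_mono powr_mono2) auto
    also have "\<dots> = C * K powr (\<delta> / 2) * ((real n + 1)\<^sup>2) powr (\<delta> / 2)"
      using K0 by (simp add: powr_mult)
    also have "((real n + 1)\<^sup>2) powr (\<delta> / 2) = (real n + 1) powr \<delta>"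
    proof -
      have "(real n + 1)\<^sup>2 = (real n + 1) powr 2" by simp
      thus ?thesis by (simp only: powr_powr) simp
    qed
    finally show ?thesis .
  qed
  thus "\<exists>C. \<forall>n. \<bar>running_max h (D n)\<bar> \<le> C * (real n + 1) powr \<delta>" by blast
qed

lemma subpolynomial_overhead:
  fixes g b :: "nat \<Rightarrow> nat"
  assumes g: "(\<lambda>n. real (g n)) \<in> o(\<lambda>n. log 2 (real n) / log 2 (log 2 (real n)))"
    and b: "(\<lambda>n. real (b n)) \<in> o(\<lambda>n. log 2 (real n))"
  shows "subpolynomial (\<lambda>n. real (overhead k (g n) (b n)))"
  unfolding subpolynomial_def
proof (intro allI impI)
  fix \<delta> :: real assume \<delta>: "\<delta> > 0"
  \<comment> \<open>The exponent of \<open>overhead\<close> is \<open>k + 1\<close> times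
    \<open>b\<close> plus \<open>g\<close>, together at most \<open>(k + 2) * d\<close> times the
    logarithm; for \<open>n \<ge> 4\<close> the iterated logarithm is at least 1.\<close>
  define d where "d = \<delta> / (real k + 2)"
  have d: "d > 0" unfolding d_def using \<delta> by simp
  have dk: "d * (real k + 2) = \<delta>" unfolding d_def by simp
  show "(\<lambda>n. real (overhead k (g n) (b n))) \<in> O(\<lambda>n. real n powr \<delta>)"
  proof (rule landau_o.bigI[of 1])
    show "eventually (\<lambda>n. norm (real (overhead k (g n) (b n))) \<le> 1 * norm (real n powr \<delta>)) at_top"
      using landau_o.smallD[OF g d] landau_o.smallD[OF b d] eventually_ge_at_top[of 4]
    proof eventually_elim
      case (elim n)
      define l where "l = log 2 (real n)"
      have l2: "l \<ge> 2" using le_log2_of_power[of 2 n] elim(3) unfolding l_def by simp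
      have "log 2 2 \<le> log 2 l" using l2 by (subst log_le_cancel_iff) auto
      hence ll: "log 2 l \<ge> 1" by simp
      have b': "real (b n) \<le> d * l" using elim(2) l2 unfolding l_def by simp
      have "real (g n) \<le> d * (l / log 2 l)" using elim(1) l2 ll unfolding l_def by simp
      also have "l / log 2 l \<le> l / 1" using l2 ll by (intro divide_left_mono) auto
      finally have g': "real (g n) \<le> d * l" using d by simp
      have "real ((k + 1) * b n + g n) = (real k + 1) * real (b n) + real (g n)" by (simp add: algebra_simps)
      also have "\<dots> \<le> (real k + 1) * (d * l) + d * l" using b' g' by (intro add_mono mult_left_mono) auto
      also have "\<dots> = d * (real k + 2) * l" by (simp add: algebra_simps)
      also have "\<dots> = \<delta> * l" unfolding dk ..
      finally have e: "real ((k + 1) * b n + g n) \<le> l * \<delta>" by (simp add: mult.commute)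
      have "real (overhead k (g n) (b n)) = 2 powr real ((k + 1) * b n + g n)"
        unfolding overhead_def by (subst powr_realpow) auto
      also have "\<dots> \<le> 2 powr (l * \<delta>)" using e by (intro powr_mono) auto
      also have "\<dots> = (2 powr l) powr \<delta>" by (simp add: powr_powr)
      also have "2 powr l = real n" unfolding l_def using elim(3) by simp
      finally show ?case by simp
    qed
  qed simp
qed

text \<open>Word bounds are pure powers of the size plus 2, so the constant factor must go into the
  exponent, by \<open>m \<le> 2 ^ m\<close>.\<close>

lemma polynomially_bounded:
  fixes D :: "nat \<Rightarrow> nat"
  assumes "\<And>n. real (D n) \<le> K * (real n + 1)\<^sup>2"
  shows "\<exists>c. \<forall>n. D n \<le> (n + 2) ^ c"
proof -
  define m where "m = nat \<lceil>K\<rceil>"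
  have "D n \<le> (n + 2) ^ (m + 2)" for n
  proof -
    have "real (D n) \<le> K * (real n + 1)\<^sup>2" by (rule assms)
    also have "\<dots> \<le> real m * real (n + 2) ^ 2"
      unfolding m_def by (intro mult_mono power_mono) (auto simp: real_nat_ceiling_ge)
    also have "\<dots> = real (m * (n + 2) ^ 2)" by simp
    finally have "D n \<le> m * (n + 2) ^ 2" by (simp only: of_nat_le_iff)
    also have "\<dots> \<le> (n + 2) ^ m * (n + 2) ^ 2"
    proof (rule mult_le_mono1)
      have "m \<le> 2 ^ m" by (simp add: less_imp_le)
      also have "(2::nat) ^ m \<le> (n + 2) ^ m" by (intro power_mono) auto
      finally show "m \<le> (n + 2) ^ m" .
    qed
    finally show ?thesis by (simp only: power_add)
  qed
  thus ?thesis by blast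
qed

section \<open>Transfer of algorithms\<close>

definition fk_graph ::
  "nat \<Rightarrow> (nat \<Rightarrow> nat) \<Rightarrow> (nat \<Rightarrow> nat) \<Rightarrow> (nat \<Rightarrow> bool list list \<Rightarrow> bool) \<Rightarrow> fk_instance \<Rightarrow> elst" where
  "fk_graph k g b f = (\<lambda>(n, Xs). reduction.graph k n (g n) (b n) (truth_table k (b n) (f n))
     (map (map (map (horner_sum of_bool 2))) (concat Xs)))"

lemma fk_graph_properties:
  fixes f :: "nat \<Rightarrow> bool list list \<Rightarrow> bool"
  assumes k: "k \<ge> 2" and I: "(n, Xs) \<in> fk_instances k g b"
  defines "J \<equiv> fk_graph k g b f (n, Xs)" and "D \<equiv> size_bound k n (g n) (b n)"
  shows "J \<in> elst_instances" "elst_size J \<le> D" "n \<le> card (edges J)" "card (edges J) \<le> D"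
    "card (colors J) = k * n" "finite (elst_paths k J)"
    "card (elst_paths k J) = factored_count (g n) (f n) (fk_sets (n, Xs))"
    "card (elst_paths k J) < ELstC_modulus k (nverts J)"
    "D \<le> B \<Longrightarrow> runs B (reduction_prog k) (init_state (fk_encode k g b f (n, Xs))) D
       (\<lambda>s. s = init_state (elst_encode J))"
proof -
  interpret factored_instance k n "g n" "b n" "f n" Xs
    by unfold_locales (use k I in \<open>auto simp: fk_instances_def factored_vectors_def\<close>)
  have J: "J = graph" unfolding J_def fk_graph_def by simp
  show "J \<in> elst_instances" unfolding J by (rule graph_instance)
  show "elst_size J \<le> D" "card (edges J) \<le> D" unfolding J D_def by (rule size_bounds)+
  show "n \<le> card (edges J)" unfolding J card_edges_graph by (rule length_all_edges_ge)
  show "card (colors J) = k * n" unfolding J by (rule card_colors_graph)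
  show "finite (elst_paths k J)" unfolding J by (rule card_elst_paths)
  show "card (elst_paths k J) = factored_count (g n) (f n) (fk_sets (n, Xs))"
    unfolding J card_elst_paths_eq sets_def fk_sets_def by simp
  show "card (elst_paths k J) < ELstC_modulus k (nverts J)" unfolding J by (rule card_elst_paths_less)
  assume "D \<le> B"
  then interpret bounded_reduction k n "g n" "b n" "truth_table k (b n) (f n)"
      "map (map (map num)) (concat Xs)" B
    by unfold_locales (use size_bounds in \<open>auto simp: D_def\<close>)
  have "fk_encode k g b f (n, Xs) = inp" unfolding inp_eq fk_encode_def by simp
  with reduction_prog_executes show "runs B (reduction_prog k) (init_state (fk_encode k g b f (n, Xs))) D
       (\<lambda>s. s = init_state (elst_encode J))" unfolding J D_def by simp
qed

text \<open>The output is taken over unchanged, so \<open>correct\<close> only compares two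
  specifications of the same words. \<open>K\<close> collects factors that depend on
  \<open>k\<close> and \<open>\<epsilon>\<close> alone.\<close>

lemma transfer_algorithm:
  fixes P :: "elst problem" and Q :: "fk_instance problem" and U :: "nat \<Rightarrow> real"
  assumes k: "k \<ge> 2"
    and g: "(\<lambda>n. real (g n)) \<in> o(\<lambda>n. log 2 (real n) / log 2 (log 2 (real n)))"
    and b: "(\<lambda>n. real (b n)) \<in> o(\<lambda>n. log 2 (real n))"
    and P: "instances P = elst_instances" "inst_size P = elst_size" "encode P = elst_encode"
    and Q: "instances Q = fk_instances k g b" "inst_size Q = fst" "encode Q = fk_encode k g b f"
    and correct: "\<And>I out. I \<in> fk_instances k g b \<Longrightarrow> correct P (fk_graph k g b f I) out \<Longrightarrow> correct Q I out"
    and K: "K \<ge> 0" and U: "\<And>n. U n \<ge> 0"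
    and T: "\<And>n Xs. (n, Xs) \<in> fk_instances k g b \<Longrightarrow>
      T (fk_graph k g b f (n, Xs)) \<le> K * real (overhead k (g n) (b n)) * U n"
    and T0: "\<And>J. T J \<ge> 0"
    and P_solvable: "solvable_in_Otilde P T"
  shows "solvable_in_Otilde Q (\<lambda>(n, Xs). U n)"
proof -
  obtain p c h where h: "subpolynomial h" and p: "\<And>I. I \<in> elst_instances \<Longrightarrow> \<exists>\<tau> s.
      exec ((elst_size I + 2) ^ c) p (init_state (elst_encode I)) \<tau> s \<and> correct P I (out_words s) \<and>
      real \<tau> \<le> h (elst_size I) * (1 + real (elst_size I) + T I)"
    using P_solvable unfolding solvable_in_Otilde_def P by blast
  define Z where "Z n = real (overhead k (g n) (b n))" for n
  define D where "D n = size_bound k n (g n) (b n)" for n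
  have Z: "subpolynomial Z" unfolding Z_def by (rule subpolynomial_overhead[OF g b])
  have Z1: "Z n \<ge> 1" for n unfolding Z_def overhead_def by simp
  have D_eq: "real (D n) = 1000 * real k * (real n + 1) * Z n" for n
    unfolding D_def size_bound_def Z_def by (simp add: algebra_simps)
  \<comment> \<open>Exponent 1 makes \<open>Z\<close> at most linear and \<open>D\<close> at most
    quadratic, enough for the word bound and for \<open>running_max\<close>.\<close>
  obtain C where C: "\<And>n. \<bar>Z n\<bar> \<le> C * (real n + 1) powr 1"
    using Z unfolding subpolynomial_iff by (metis zero_less_one)
  have D_le: "real (D n) + 2 \<le> (1000 * real k * C + 2) * (real n + 1)\<^sup>2" for n
  proof -
    have "Z n \<le> C * (real n + 1)" using C[of n] by simp
    hence "real (D n) \<le> 1000 * real k * (real n + 1) * (C * (real n + 1))"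
      unfolding D_eq by (intro mult_left_mono) auto
    also have "\<dots> = 1000 * real k * C * (real n + 1)\<^sup>2" by (simp add: power2_eq_square)
    finally have "real (D n) \<le> 1000 * real k * C * (real n + 1)\<^sup>2" .
    moreover have "2 * 1 \<le> 2 * (real n + 1)\<^sup>2" by (intro mult_left_mono) (auto simp: one_le_power)
    ultimately show ?thesis unfolding distrib_right by linarith
  qed
  have "\<exists>c. \<forall>n. D n + 2 \<le> (n + 2) ^ c"
    by (rule polynomially_bounded[of _ "1000 * real k * C + 2"]) (use D_le in \<open>simp add: add.commute\<close>)
  then obtain d where d: "\<And>n. D n + 2 \<le> (n + 2) ^ d" by blast
  define H where "H n = running_max h (D n)" for n
  have H: "subpolynomial H"
    unfolding H_def by (rule subpolynomial_running_max_comp[OF h, of _ "1000 * real k * C + 2"])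
      (use D_le in \<open>smt (verit)\<close>)
  \<comment> \<open>The first summand pays for the reduction, the second for the given program on a
    graph of size at most \<open>D n\<close>.\<close>
  define h' where "h' n = 1000 * real k * Z n + H n * (1 + 1000 * real k * Z n + K * Z n)" for n
  have h': "subpolynomial h'"
    unfolding h'_def by (intro subpolynomial_add subpolynomial_mult subpolynomial_const Z H)
  show ?thesis
    unfolding solvable_in_Otilde_def Q
  \<comment> \<open>The summand \<open>d\<close> of the exponent serves the reduction,
    \<open>d * c\<close> the given program, whose bound is \<open>(elst_size J + 2) ^ c\<close> with
    \<open>elst_size J + 2 \<le> (n + 2) ^ d\<close>.\<close>
  proof (rule exI[of _ "Seq (reduction_prog k) p"], rule exI[of _ "d * c + d"], rule exI[of _ h'],
      rule conjI[OF h'], rule ballI)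
    fix I assume I: "I \<in> fk_instances k g b"
    obtain n Xs where I_eq: "I = (n, Xs)" by force
    define J where "J = fk_graph k g b f (n, Xs)"
    note props = fk_graph_properties[OF k I[unfolded I_eq], where f = f, folded J_def D_def]
    define B where "B = (n + 2) ^ (d * c + d)"
    have B1: "D n \<le> B"
    proof -
      have "D n \<le> (n + 2) ^ d" using d[of n] by simp
      also have "\<dots> \<le> B" unfolding B_def by (intro power_increasing) auto
      finally show ?thesis .
    qed
    have B2: "(elst_size J + 2) ^ c \<le> B"
    proof -
      have "(elst_size J + 2) ^ c \<le> ((n + 2) ^ d) ^ c"
        using props(2) d[of n] by (intro power_mono) auto
      also have "\<dots> = (n + 2) ^ (d * c)" by (simp only: power_mult)
      also have "\<dots> \<le> B" unfolding B_def by (intro power_increasing) auto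
      finally show ?thesis .
    qed
    obtain \<tau>1 where t1: "\<tau>1 \<le> D n" "exec B (reduction_prog k) (init_state (fk_encode k g b f (n, Xs))) \<tau>1
        (init_state (elst_encode J))"
      using props(9)[OF B1] unfolding runs_def by blast
    obtain \<tau>2 s where t2: "exec ((elst_size J + 2) ^ c) p (init_state (elst_encode J)) \<tau>2 s"
      "correct P J (out_words s)" "real \<tau>2 \<le> h (elst_size J) * (1 + real (elst_size J) + T J)"
      using p[OF props(1)] by blast
    have ex: "exec B (Seq (reduction_prog k) p) (init_state (fk_encode k g b f I)) (\<tau>1 + \<tau>2) s"
      unfolding I_eq by (rule exec.intros(6)[OF t1(2) exec_mono_bound[OF t2(1) B2]])
    have time: "real (\<tau>1 + \<tau>2) \<le> h' n * (1 + real n + U n)"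
    proof -
      let ?S = "1 + real n + U n"
      have S: "?S \<ge> 1 + real n" "?S \<ge> U n" "?S \<ge> 1" using U[of n] by auto
      have "real \<tau>1 \<le> real (D n)" using t1(1) by simp
      also have "\<dots> = 1000 * real k * Z n * (1 + real n)" unfolding D_eq by (simp add: algebra_simps)
      also have "\<dots> \<le> 1000 * real k * Z n * ?S" using S Z1[of n] by (intro mult_left_mono) auto
      finally have 1: "real \<tau>1 \<le> 1000 * real k * Z n * ?S" .
      have Dn: "real (D n) \<le> 1000 * real k * Z n * ?S"
        unfolding D_eq using S Z1[of n] by (simp add: algebra_simps mult_left_mono)
      have TJ: "T J \<le> K * Z n * ?S"
      proof -
        have "T J \<le> K * Z n * U n" unfolding J_def Z_def using T I unfolding I_eq by blast
        also have "\<dots> \<le> K * Z n * ?S" using S K Z1[of n] by (intro mult_left_mono) auto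
        finally show ?thesis .
      qed
      have "h (elst_size J) * (1 + real (elst_size J) + T J) \<le> H n * ((1 + 1000 * real k * Z n + K * Z n) * ?S)"
      proof (rule mult_mono)
        show "h (elst_size J) \<le> H n"
          using running_max_ge[OF props(2), of h] unfolding H_def by linarith
        show "0 \<le> H n" using running_max_ge[of 0 "D n" h] unfolding H_def by linarith
        have "real (elst_size J) \<le> real (D n)" using props(2) by simp
        thus "1 + real (elst_size J) + T J \<le> (1 + 1000 * real k * Z n + K * Z n) * ?S"
          using Dn TJ S(3) unfolding distrib_right mult_1_left by linarith
        show "0 \<le> 1 + real (elst_size J) + T J" using T0[of J] by simp
      qed
      hence "real \<tau>2 \<le> H n * ((1 + 1000 * real k * Z n + K * Z n) * ?S)" using t2(3) by simp
      with 1 show ?thesis unfolding h'_def by (simp add: algebra_simps)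
    qed
    show "\<exists>\<tau> s. exec ((fst I + 2) ^ (d * c + d)) (Seq (reduction_prog k) p) (init_state (fk_encode k g b f I)) \<tau> s \<and>
       correct Q I (out_words s) \<and> real \<tau> \<le> h' (fst I) * (1 + real (fst I) + (case I of (n, Xs) \<Rightarrow> U n))"
    proof (intro exI[of _ "\<tau>1 + \<tau>2"] exI[of _ s] conjI)
      show "exec ((fst I + 2) ^ (d * c + d)) (Seq (reduction_prog k) p) (init_state (fk_encode k g b f I))
          (\<tau>1 + \<tau>2) s" using ex unfolding B_def I_eq by simp
      show "correct Q I (out_words s)" using correct[OF I] t2(2) unfolding J_def I_eq by blast
      show "real (\<tau>1 + \<tau>2) \<le> h' (fst I) * (1 + real (fst I) + (case I of (n, Xs) \<Rightarrow> U n))"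
        using time unfolding I_eq by simp
    qed
  qed
qed

section \<open>Both time bounds in terms of n\<close>

lemma time_bound_colors:
  fixes n m k :: nat and Z a :: real
  assumes "real m \<le> 1000 * real k * (real n + 1) * Z" "Z \<ge> 1"
  shows "real m * real (k * n) powr a \<le> 2000 * real k * real k powr a * Z * real n powr (a + 1)"
\<comment> \<open>For \<open>n = 0\<close> both sides are 0, because \<open>0 powr a = 0\<close>;
  otherwise \<open>n + 1 \<le> 2 * n\<close>, which doubles the constant.\<close>
proof (cases "n = 0")
  case False
  have "real m \<le> 1000 * real k * (real n + 1) * Z" by (rule assms)
  also have "\<dots> \<le> 1000 * real k * (2 * real n) * Z"
    using False assms(2) by (intro mult_right_mono mult_left_mono) auto
  finally have "real m * real (k * n) powr a \<le> 1000 * real k * (2 * real n) * Z * real (k * n) powr a"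
    by (rule mult_right_mono) simp
  also have "\<dots> = 2000 * real k * real k powr a * Z * (real n * real n powr a)"
    by (simp add: powr_mult)
  also have "real n * real n powr a = real n powr (a + 1)" using False by (simp add: powr_add)
  finally show ?thesis .
qed simp

text \<open>For \<open>\<epsilon> \<le> 1\<close> the power grows with \<open>m\<close>, and the
  upper bound on \<open>m\<close> applies; for \<open>\<epsilon> > 1\<close> it decreases, and
  \<open>n \<le> m\<close> applies.\<close>

lemma time_bound_edges:
  fixes n m k :: nat and Z a \<epsilon> :: real
  assumes "real m \<le> 1000 * real k * (real n + 1) * Z" "Z \<ge> 1" "n \<le> m" "k \<ge> 1" "\<epsilon> > 0"
  shows "real m powr (1 - \<epsilon>) * real (k * n) powr a \<le>
    2000 * real k * real k powr a * Z * real n powr (a + 1 - \<epsilon>)"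
proof (cases "n = 0")
  case False
  define C where "C = 2000 * real k * Z"
  have "1 * 1 \<le> (2000 * real k) * Z" using assms by (intro mult_mono) auto
  hence C1: "C \<ge> 1" unfolding C_def by simp
  have "real m \<le> 1000 * real k * (real n + 1) * Z" by (rule assms)
  also have "\<dots> \<le> 1000 * real k * (2 * real n) * Z"
    using False assms(2) by (intro mult_right_mono mult_left_mono) auto
  also have "\<dots> = C * real n" unfolding C_def by simp
  finally have m: "real m \<le> C * real n" .
  have "real m powr (1 - \<epsilon>) \<le> C * real n powr (1 - \<epsilon>)"
  proof (cases "\<epsilon> \<le> 1")
    case True
    have "real m powr (1 - \<epsilon>) \<le> (C * real n) powr (1 - \<epsilon>)" using m True by (intro powr_mono2) auto
    also have "\<dots> = C powr (1 - \<epsilon>) * real n powr (1 - \<epsilon>)" using C1 by (simp add: powr_mult)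
    also have "C powr (1 - \<epsilon>) \<le> C powr 1" using C1 assms(5) by (intro powr_mono) auto
    finally show ?thesis using C1 by (simp add: mult_right_mono)
  next
    case False': False
    have "real m powr (1 - \<epsilon>) \<le> real n powr (1 - \<epsilon>)"
      using False False' assms(3) by (intro powr_mono2') auto
    also have "\<dots> = 1 * real n powr (1 - \<epsilon>)" by simp
    also have "\<dots> \<le> C * real n powr (1 - \<epsilon>)" using C1 by (intro mult_right_mono) auto
    finally show ?thesis .
  qed
  hence "real m powr (1 - \<epsilon>) * real (k * n) powr a \<le> C * real n powr (1 - \<epsilon>) * real (k * n) powr a"
    by (rule mult_right_mono) simp
  also have "\<dots> = 2000 * real k * real k powr a * Z * (real n powr a * real n powr (1 - \<epsilon>))"
    unfolding C_def by (simp add: powr_mult)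
  also have "real n powr a * real n powr (1 - \<epsilon>) = real n powr (a + 1 - \<epsilon>)"
    by (simp add: add_diff_eq flip: powr_add)
  finally show ?thesis .
qed simp

lemma transfer_both_bounds:
  fixes P :: "elst problem" and Q :: "fk_instance problem" and \<epsilon> :: real
  assumes k: "k \<ge> 2" and \<epsilon>: "\<epsilon> > 0"
    and g: "(\<lambda>n. real (g n)) \<in> o(\<lambda>n. log 2 (real n) / log 2 (log 2 (real n)))"
    and b: "(\<lambda>n. real (b n)) \<in> o(\<lambda>n. log 2 (real n))"
    and P: "instances P = elst_instances" "inst_size P = elst_size" "encode P = elst_encode"
    and Q: "instances Q = fk_instances k g b" "inst_size Q = fst" "encode Q = fk_encode k g b f"
    and correct: "\<And>I out. I \<in> fk_instances k g b \<Longrightarrow> correct P (fk_graph k g b f I) out \<Longrightarrow> correct Q I out"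
    and solvable: "solvable_in_Otilde P
        (\<lambda>I. real (card (edges I)) * real (card (colors I)) powr (real k - 1 - \<epsilon>)) \<or>
      solvable_in_Otilde P
        (\<lambda>I. real (card (edges I)) powr (1 - \<epsilon>) * real (card (colors I)) powr (real k - 1))"
  shows "solvable_in_Otilde Q (\<lambda>(n, Xs). real n powr (real k - \<epsilon>))"
proof -
  have size: "real (card (edges (fk_graph k g b f (n, Xs)))) \<le>
      1000 * real k * (real n + 1) * real (overhead k (g n) (b n))" if "(n, Xs) \<in> fk_instances k g b" for n Xs
  proof -
    have "real (card (edges (fk_graph k g b f (n, Xs)))) \<le> real (size_bound k n (g n) (b n))"
      using fk_graph_properties(4)[OF k that] by simp
    thus ?thesis by (simp add: size_bound_def algebra_simps)
  qed
  have Z1: "real (overhead k (g n) (b n)) \<ge> 1" for n unfolding overhead_def by simp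
  note transfer = transfer_algorithm[OF k g b P Q correct, where U = "\<lambda>n. real n powr (real k - \<epsilon>)"]
  from solvable show ?thesis
  proof
    assume s: "solvable_in_Otilde P
        (\<lambda>I. real (card (edges I)) * real (card (colors I)) powr (real k - 1 - \<epsilon>))"
    show ?thesis
    proof (rule transfer[OF _ _ _ _ _ _ s])
      fix n Xs assume I: "(n, Xs) \<in> fk_instances k g b"
      have "real k - 1 - \<epsilon> + 1 = real k - \<epsilon>" by simp
      thus "real (card (edges (fk_graph k g b f (n, Xs)))) *
          real (card (colors (fk_graph k g b f (n, Xs)))) powr (real k - 1 - \<epsilon>)
        \<le> 2000 * real k * real k powr (real k - 1 - \<epsilon>) * real (overhead k (g n) (b n)) * real n powr (real k - \<epsilon>)"
        using time_bound_colors[OF size[OF I] Z1, of "real k - 1 - \<epsilon>"]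
        unfolding fk_graph_properties(5)[OF k I] by simp
    qed auto
  next
    assume s: "solvable_in_Otilde P
        (\<lambda>I. real (card (edges I)) powr (1 - \<epsilon>) * real (card (colors I)) powr (real k - 1))"
    show ?thesis
    proof (rule transfer[OF _ _ _ _ _ _ s])
      fix n Xs assume I: "(n, Xs) \<in> fk_instances k g b"
      have "real k - 1 + 1 - \<epsilon> = real k - \<epsilon>" by simp
      thus "real (card (edges (fk_graph k g b f (n, Xs)))) powr (1 - \<epsilon>) *
          real (card (colors (fk_graph k g b f (n, Xs)))) powr (real k - 1)
        \<le> 2000 * real k * real k powr (real k - 1) * real (overhead k (g n) (b n)) * real n powr (real k - \<epsilon>)"
        using time_bound_edges[OF size[OF I] Z1 fk_graph_properties(3)[OF k I] _ \<epsilon>, of "real k - 1"] k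
        unfolding fk_graph_properties(5)[OF k I] by simp
    qed auto
  qed
qed

theorem theorem1p13:
  fixes k :: nat and \<epsilon> :: real
    and g b :: "nat \<Rightarrow> nat"
    and f :: "nat \<Rightarrow> bool list list \<Rightarrow> bool"
  assumes "k \<ge> 2" and "\<epsilon> > 0"
    and "(\<lambda>n. real (g n)) \<in> o(\<lambda>n. log 2 (real n) / log 2 (log 2 (real n)))"
    and "(\<lambda>n. real (b n)) \<in> o(\<lambda>n. log 2 (real n))"
  shows
    "(solvable_in_Otilde (ELstC k)
        (\<lambda>I. real (card (edges I)) * real (card (colors I)) powr (real k - 1 - \<epsilon>)) \<or>
      solvable_in_Otilde (ELstC k)
        (\<lambda>I. real (card (edges I)) powr (1 - \<epsilon>) * real (card (colors I)) powr (real k - 1))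
      \<longrightarrow> solvable_in_Otilde (F k g b f) (\<lambda>(n, X). real n powr (real k - \<epsilon>)))
     \<and>
     (solvable_in_Otilde (count_ELstC_mod k (ELstC_modulus k))
        (\<lambda>I. real (card (edges I)) * real (card (colors I)) powr (real k - 1 - \<epsilon>)) \<or>
      solvable_in_Otilde (count_ELstC_mod k (ELstC_modulus k))
        (\<lambda>I. real (card (edges I)) powr (1 - \<epsilon>) * real (card (colors I)) powr (real k - 1))
      \<longrightarrow> solvable_in_Otilde (count_F k g b f) (\<lambda>(n, X). real n powr (real k - \<epsilon>)))"
proof (intro conjI impI)
  assume "solvable_in_Otilde (ELstC k)
        (\<lambda>I. real (card (edges I)) * real (card (colors I)) powr (real k - 1 - \<epsilon>)) \<or>
      solvable_in_Otilde (ELstC k)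
        (\<lambda>I. real (card (edges I)) powr (1 - \<epsilon>) * real (card (colors I)) powr (real k - 1))"
  thus "solvable_in_Otilde (F k g b f) (\<lambda>(n, X). real n powr (real k - \<epsilon>))"
  proof (rule transfer_both_bounds[OF assms, rotated -1])
    fix I out assume "I \<in> fk_instances k g b" "correct (ELstC k) (fk_graph k g b f I) out"
    moreover obtain n Xs where "I = (n, Xs)" by force
    \<comment> \<open>Since the set of paths is finite, it is nonempty exactly if its cardinality is
      positive.\<close>
    ultimately show "correct (F k g b f) I out"
      using fk_graph_properties(6,7)[OF assms(1), of n Xs g b f]
      by (simp add: ELstC_def F_def card_gt_0_iff flip: fk_graph_properties(7)[OF assms(1)])
  qed (simp_all add: ELstC_def F_def)
next
  assume "solvable_in_Otilde (count_ELstC_mod k (ELstC_modulus k))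
        (\<lambda>I. real (card (edges I)) * real (card (colors I)) powr (real k - 1 - \<epsilon>)) \<or>
      solvable_in_Otilde (count_ELstC_mod k (ELstC_modulus k))
        (\<lambda>I. real (card (edges I)) powr (1 - \<epsilon>) * real (card (colors I)) powr (real k - 1))"
  thus "solvable_in_Otilde (count_F k g b f) (\<lambda>(n, X). real n powr (real k - \<epsilon>))"
  proof (rule transfer_both_bounds[OF assms, rotated -1])
    fix I out
    assume "I \<in> fk_instances k g b" "correct (count_ELstC_mod k (ELstC_modulus k)) (fk_graph k g b f I) out"
    moreover obtain n Xs where "I = (n, Xs)" by force
    \<comment> \<open>The number of paths is below the modulus, so the remainder is the number
      itself.\<close>
    ultimately show "correct (count_F k g b f) I out"
      using fk_graph_properties(7,8)[OF assms(1), of n Xs g b f]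
      by (simp add: count_ELstC_mod_def count_F_def)
  qed (simp_all add: count_ELstC_mod_def count_F_def)
qed

end
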